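(* Let $X$ be a curve over a finite field with canonical divisor $K$, $D=P_1+\cdots+P_n$ a sum of $n$ distinct rational points and $G$ a divisor disjoint from $D$. Then \[ d(C_L(D,G))=\min\{\deg A : 0\leq A\leq D,\ L(A-C)\neq L(-C)\}\quad\text{for } C=D-G, \] \[ d(C_\Omega(D,G))=\min\{\deg A : 0\leq A\leq D,\ L(A-C)\neq L(-C)\}\quad\text{for } C=G-K. \]
   Context: $L(E)=\{f:(f)+E\ge0\}\cup\{0\}$, $\Omega(E)$ the differentials $\omega$ with $(\omega)\ge E$ together with $0$. $C_L(D,G)$ is the image of $L(G)\to\mathbb{F}^n$, $f\mapsto(f(P_1),\ldots,f(P_n))$; $C_\Omega(D,G)$ is the image of $\Omega(G-D)\to\mathbb{F}^n$, $\omega\mapsto(\mathrm{res}_{P_1}\omega,\ldots,\mathrm{res}_{P_n}\omega)$. $d(\cdot)$ denotes the minimum Hamming distance of a code. *)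

theory Defs
  imports
    "HOL-Library.Poly_Mapping"
    "HOL-Library.Extended_Nat"
    "HOL-Library.FuncSet"
    "HOL-Computational_Algebra.Polynomial"
begin

text \<open>
  A smooth projective absolutely irreducible curve over a field \<open>k\<close> is represented by its function
  field: an extension \<open>F\<close> of \<open>k\<close> (given by the embedding \<open>emb\<close> of \<open>k\<close> into \<open>F\<close>) that is finite
  over \<open>k(x)\<close> for some transcendental \<open>x\<close> and in which \<open>k\<close> is algebraically closed. For perfect \<open>k\<close>,
  the last condition says that the curve is absolutely irreducible. The closed points of
  the curve are the discrete valuations of \<open>F\<close> over \<open>k\<close>.
\<close>

section \<open>Function fields and points\<close>

definition algebraic_over :: "('k::field \<Rightarrow> 'a::field) \<Rightarrow> 'a \<Rightarrow> bool" where
  "algebraic_over emb x \<longleftrightarrow> (\<exists>p. p \<noteq> 0 \<and> poly (map_poly emb p) x = 0)"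

definition rational_functions_in :: "('k::field \<Rightarrow> 'a::field) \<Rightarrow> 'a \<Rightarrow> 'a set" where
  "rational_functions_in emb x =
     {poly (map_poly emb p) x / poly (map_poly emb q) x | p q. poly (map_poly emb q) x \<noteq> 0}"

locale curve_function_field =
  fixes emb :: "'k::field \<Rightarrow> 'a::field"
  assumes emb_one: "emb 1 = 1"
    and emb_add: "emb (a + b) = emb a + emb b"
    and emb_mult: "emb (a * b) = emb a * emb b"
    and one_variable:
      "\<exists>x. \<not> algebraic_over emb x \<and>
        (\<exists>B. finite B \<and>
          (\<forall>f. \<exists>c. (\<forall>b\<in>B. c b \<in> rational_functions_in emb x) \<and> f = (\<Sum>b\<in>B. c b * b)))"
    and full_constant_field: "algebraic_over emb f \<Longrightarrow> f \<in> range emb"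

text \<open>
  A point is identified with its normalized discrete valuation. The valuation of \<open>0\<close> is infinite;
  here it gets the dummy value \<open>0\<close>, so that every point corresponds to exactly one function.
\<close>

type_synonym 'a point = "'a \<Rightarrow> int"

definition points :: "('k::field \<Rightarrow> 'a::field) \<Rightarrow> 'a point set" where
  "points emb = {v.
     v 0 = 0 \<and>
     (\<forall>f g. f \<noteq> 0 \<longrightarrow> g \<noteq> 0 \<longrightarrow> v (f * g) = v f + v g) \<and>
     (\<forall>f g. f \<noteq> 0 \<longrightarrow> g \<noteq> 0 \<longrightarrow> f + g \<noteq> 0 \<longrightarrow> min (v f) (v g) \<le> v (f + g)) \<and>
     (\<forall>c. c \<noteq> 0 \<longrightarrow> v (emb c) = 0) \<and>
     (\<exists>t. t \<noteq> 0 \<and> v t = 1)}"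

definition local_ring :: "'a::field point \<Rightarrow> 'a set" where
  "local_ring P = {f. f = 0 \<or> P f \<ge> 0}"

definition maximal_ideal :: "'a::field point \<Rightarrow> 'a set" where
  "maximal_ideal P = {f. f = 0 \<or> P f > 0}"

text \<open>\<open>B\<close> represents a \<open>k\<close>-basis of the residue field \<open>local_ring P / maximal_ideal P\<close>.\<close>

definition residue_field_basis :: "('k::field \<Rightarrow> 'a::field) \<Rightarrow> 'a point \<Rightarrow> 'a set \<Rightarrow> bool" where
  "residue_field_basis emb P B \<longleftrightarrow>
     finite B \<and> B \<subseteq> local_ring P \<and>
     (\<forall>f \<in> local_ring P. \<exists>!c. c \<in> B \<rightarrow>\<^sub>E UNIV \<and> f - (\<Sum>b\<in>B. emb (c b) * b) \<in> maximal_ideal P)"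

definition point_degree :: "('k::field \<Rightarrow> 'a::field) \<Rightarrow> 'a point \<Rightarrow> nat" where
  "point_degree emb P = (THE d. \<exists>B. residue_field_basis emb P B \<and> card B = d)"

definition rational_points :: "('k::field \<Rightarrow> 'a::field) \<Rightarrow> 'a point set" where
  "rational_points emb =
     {P \<in> points emb. \<forall>f \<in> local_ring P. \<exists>c. f - emb c \<in> maximal_ideal P}"

definition value_at :: "('k::field \<Rightarrow> 'a::field) \<Rightarrow> 'a point \<Rightarrow> 'a \<Rightarrow> 'k" where
  "value_at emb P f = (THE c. f - emb c \<in> maximal_ideal P)"

section \<open>Divisors\<close>

type_synonym 'a divisor = "'a point \<Rightarrow>\<^sub>0 int"

definition is_divisor :: "('k::field \<Rightarrow> 'a::field) \<Rightarrow> 'a divisor \<Rightarrow> bool" where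
  "is_divisor emb E \<longleftrightarrow> Poly_Mapping.keys E \<subseteq> points emb"

text \<open>The order \<open>\<le>\<close> that the library puts on \<open>\<Rightarrow>\<^sub>0\<close> is not the pointwise one.\<close>

definition divisor_le :: "'a divisor \<Rightarrow> 'a divisor \<Rightarrow> bool" where
  "divisor_le E E' \<longleftrightarrow> (\<forall>P. Poly_Mapping.lookup E P \<le> Poly_Mapping.lookup E' P)"

definition divisor_degree :: "('k::field \<Rightarrow> 'a::field) \<Rightarrow> 'a divisor \<Rightarrow> int" where
  "divisor_degree emb E =
     (\<Sum>P\<in>Poly_Mapping.keys E. Poly_Mapping.lookup E P * int (point_degree emb P))"

definition points_divisor :: "'a point list \<Rightarrow> 'a divisor" where
  "points_divisor Ps = (\<Sum>P\<leftarrow>Ps. Poly_Mapping.single P 1)"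

definition riemann_roch_space :: "('k::field \<Rightarrow> 'a::field) \<Rightarrow> 'a divisor \<Rightarrow> 'a set" where
  "riemann_roch_space emb E =
     {f. f \<noteq> 0 \<longrightarrow> (\<forall>P \<in> points emb. P f + Poly_Mapping.lookup E P \<ge> 0)}"

section \<open>Differentials\<close>

text \<open>
  Kaehler differentials of \<open>F\<close> over \<open>k\<close>: the free \<open>F\<close>-module on symbols \<open>dz\<close>, where
  \<open>single z u\<close> stands for \<open>u dz\<close>, modulo the submodule generated by additivity, the Leibniz rule and
  \<open>dc = 0\<close> for constants. A differential is a coset of that submodule.
\<close>

definition kaehler_relations :: "('k::field \<Rightarrow> 'a::field) \<Rightarrow> ('a \<Rightarrow>\<^sub>0 'a) set" where
  "kaehler_relations emb = module.span (\<lambda>a. Poly_Mapping.map ((*) a))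
     ({Poly_Mapping.single (x + y) 1 - Poly_Mapping.single x 1 - Poly_Mapping.single y 1 | x y. True}
      \<union> {Poly_Mapping.single (x * y) 1 - Poly_Mapping.single y x - Poly_Mapping.single x y | x y. True}
      \<union> {Poly_Mapping.single (emb c) 1 | c. True})"

lemma module_poly_mapping:
  "module (\<lambda>a :: 'a::field. Poly_Mapping.map ((*) a) :: ('b \<Rightarrow>\<^sub>0 'a) \<Rightarrow> _)"
  by unfold_locales
    (auto intro!: poly_mapping_eqI simp: map.rep_eq lookup_add when_def algebra_simps
       add_eq_0_iff)

type_synonym 'a differential = "('a \<Rightarrow>\<^sub>0 'a) set"

definition kaehler_class :: "('k::field \<Rightarrow> 'a::field) \<Rightarrow> ('a \<Rightarrow>\<^sub>0 'a) \<Rightarrow> 'a differential" where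
  "kaehler_class emb w = {w'. w' - w \<in> kaehler_relations emb}"

definition differentials :: "('k::field \<Rightarrow> 'a::field) \<Rightarrow> 'a differential set" where
  "differentials emb = range (kaehler_class emb)"

definition zero_differential :: "('k::field \<Rightarrow> 'a::field) \<Rightarrow> 'a differential" where
  "zero_differential emb = kaehler_class emb 0"

text \<open>
  Order and residue of a differential at \<open>P\<close> are read off from \<open>\<omega> = u dt\<close> for a uniformizer \<open>t\<close>
  at \<open>P\<close>; neither depends on the choice of \<open>t\<close>.
\<close>

definition uniformizer :: "'a::field point \<Rightarrow> 'a" where
  "uniformizer P = (SOME t. t \<noteq> 0 \<and> P t = 1)"

definition local_coefficient ::
    "('k::field \<Rightarrow> 'a::field) \<Rightarrow> 'a point \<Rightarrow> 'a differential \<Rightarrow> 'a" where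
  "local_coefficient emb P \<omega> =
     (THE u. \<omega> = kaehler_class emb (Poly_Mapping.single (uniformizer P) u))"

definition differential_order ::
    "('k::field \<Rightarrow> 'a::field) \<Rightarrow> 'a point \<Rightarrow> 'a differential \<Rightarrow> int" where
  "differential_order emb P \<omega> = P (local_coefficient emb P \<omega>)"

text \<open>\<open>f = (\<Sum>i. c i * t ^ i)\<close> in the completion of \<open>F\<close> at a rational point \<open>P\<close> with uniformizer \<open>t\<close>.\<close>

definition laurent_expansion ::
    "('k::field \<Rightarrow> 'a::field) \<Rightarrow> 'a point \<Rightarrow> 'a \<Rightarrow> 'a \<Rightarrow> (int \<Rightarrow> 'k) \<Rightarrow> bool" where
  "laurent_expansion emb P t f c \<longleftrightarrow>
     (\<exists>m. (\<forall>i<m. c i = 0) \<and>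
       (\<forall>N\<ge>m. let r = f - (\<Sum>i=m..N. emb (c i) * t powi i) in r = 0 \<or> P r > N))"

definition residue_at ::
    "('k::field \<Rightarrow> 'a::field) \<Rightarrow> 'a point \<Rightarrow> 'a differential \<Rightarrow> 'k" where
  "residue_at emb P \<omega> =
     (THE c. laurent_expansion emb P (uniformizer P) (local_coefficient emb P \<omega>) c) (- 1)"

definition differential_space ::
    "('k::field \<Rightarrow> 'a::field) \<Rightarrow> 'a divisor \<Rightarrow> 'a differential set" where
  "differential_space emb E =
     {\<omega> \<in> differentials emb. \<omega> \<noteq> zero_differential emb \<longrightarrow>
        (\<forall>P \<in> points emb. differential_order emb P \<omega> \<ge> Poly_Mapping.lookup E P)}"

definition canonical_divisor :: "('k::field \<Rightarrow> 'a::field) \<Rightarrow> 'a divisor \<Rightarrow> bool" where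
  "canonical_divisor emb K \<longleftrightarrow> is_divisor emb K \<and>
     (\<exists>\<omega> \<in> differentials emb. \<omega> \<noteq> zero_differential emb \<and>
        (\<forall>P \<in> points emb. Poly_Mapping.lookup K P = differential_order emb P \<omega>))"

section \<open>Codes\<close>

definition hamming_distance :: "'k list \<Rightarrow> 'k list \<Rightarrow> nat" where
  "hamming_distance x y = card {i. i < length x \<and> x ! i \<noteq> y ! i}"

text \<open>The minimum over the empty set (for a code with only one word) is \<open>\<infinity>\<close>.\<close>

definition minimum_distance :: "'k list set \<Rightarrow> enat" where
  "minimum_distance C = Inf {enat (hamming_distance x y) | x y. x \<in> C \<and> y \<in> C \<and> x \<noteq> y}"

definition code_L :: "('k::field \<Rightarrow> 'a::field) \<Rightarrow> 'a point list \<Rightarrow> 'a divisor \<Rightarrow> 'k list set" where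
  "code_L emb Ps G = (\<lambda>f. map (\<lambda>P. value_at emb P f) Ps) ` riemann_roch_space emb G"

definition code_Omega :: "('k::field \<Rightarrow> 'a::field) \<Rightarrow> 'a point list \<Rightarrow> 'a divisor \<Rightarrow> 'k list set" where
  "code_Omega emb Ps G =
     (\<lambda>\<omega>. map (\<lambda>P. residue_at emb P \<omega>) Ps) ` differential_space emb (G - points_divisor Ps)"

end

theory Submission
  imports Defs "HOL-Computational_Algebra.Primes"
begin

text \<open>
  Let \<open>E = D - C\<close>, so that \<open>E = G\<close> for \<open>C\<^sub>L\<close> and \<open>E = D + K - G\<close> for \<open>C\<^sub>\<Omega>\<close>. A differential \<open>\<omega>\<^sub>0\<close> with
  divisor \<open>K\<close> gives an isomorphism \<open>f \<mapsto> f \<omega>\<^sub>0\<close> from \<open>L(D + K - G)\<close> to \<open>\<Omega>(G - D)\<close>, hence both codes are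
  images of \<open>L(E)\<close> under maps that read off, at each \<open>P\<^sub>i\<close>, the coefficient of the smallest order
  permitted by \<open>E\<close>. The word of \<open>f\<close> is supported in \<open>A \<le> D\<close> iff \<open>f \<in> L(A - C)\<close>, and it is zero iff
  \<open>f \<in> L(-C)\<close>.

  For the differentials one needs that \<open>dt\<close> is a basis of the Kaehler differentials whenever \<open>t\<close> is a
  uniformizer at some point. Let \<open>p\<close> be the characteristic. As \<open>k\<close> is perfect, \<open>[F : F ^ p] \<le> p\<close>, and
  \<open>1, t, \<dots>, t ^ (p - 1)\<close> are independent over \<open>F ^ p\<close> because their orders differ modulo \<open>p\<close>.
  Hence \<open>F = F ^ p (t)\<close>, which shows that \<open>dt\<close> generates, and formal differentiation with respect to
  \<open>t\<close> is a well-defined derivation of \<open>F\<close> over \<open>k\<close>, which shows that \<open>dt\<close> is nonzero.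
\<close>

section \<open>Orders and values at points\<close>

text \<open>Points send \<open>0\<close> to the dummy value \<open>0\<close>; the disjunct
  \<open>f = 0\<close> restores its infinite order, so that the elements of order at least
  \<open>n\<close> are closed under addition.\<close>

definition order_ge :: "'a::field point \<Rightarrow> int \<Rightarrow> 'a \<Rightarrow> bool" where
  "order_ge P n f \<longleftrightarrow> f = 0 \<or> n \<le> P f"

lemma order_ge_0 [simp]: "order_ge P n 0"
  by (simp add: order_ge_def)

lemma order_ge_mono: "order_ge P n f \<Longrightarrow> m \<le> n \<Longrightarrow> order_ge P m f"
  by (auto simp: order_ge_def)

lemma local_ring_iff: "f \<in> local_ring P \<longleftrightarrow> order_ge P 0 f"
  by (simp add: local_ring_def order_ge_def)

lemma maximal_ideal_iff: "f \<in> maximal_ideal P \<longleftrightarrow> order_ge P 1 f"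
  by (auto simp: maximal_ideal_def order_ge_def)

lemma riemann_roch_space_iff:
  "f \<in> riemann_roch_space emb E \<longleftrightarrow>
     (\<forall>P \<in> points emb. order_ge P (- Poly_Mapping.lookup E P) f)"
  by (force simp: riemann_roch_space_def order_ge_def)

lemma
  assumes "P \<in> points emb"
  shows point_mult: "f \<noteq> 0 \<Longrightarrow> g \<noteq> 0 \<Longrightarrow> P (f * g) = P f + P g"
    and point_add: "f \<noteq> 0 \<Longrightarrow> g \<noteq> 0 \<Longrightarrow> f + g \<noteq> 0 \<Longrightarrow> min (P f) (P g) \<le> P (f + g)"
    and point_emb: "c \<noteq> 0 \<Longrightarrow> P (emb c) = 0"
    and ex_uniformizer: "\<exists>t. t \<noteq> 0 \<and> P t = 1"
  using assms unfolding points_def by blast+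

lemma uniformizer:
  assumes "P \<in> points emb"
  shows "uniformizer P \<noteq> 0" "P (uniformizer P) = 1"
  using someI_ex [OF ex_uniformizer [OF assms]] by (auto simp: uniformizer_def)

lemma rational_points_subset: "rational_points emb \<subseteq> points emb"
  by (auto simp: rational_points_def)

lemma lookup_points_divisor:
  "distinct Ps \<Longrightarrow> Poly_Mapping.lookup (points_divisor Ps) P = (if P \<in> set Ps then 1 else 0)"
  by (induction Ps) (auto simp: points_divisor_def lookup_add lookup_single when_def)

lemma keys_points_divisor: "distinct Ps \<Longrightarrow> Poly_Mapping.keys (points_divisor Ps) = set Ps"
  by (auto simp: in_keys_iff lookup_points_divisor split: if_splits)

lemma hamming_distance_map:
  assumes "distinct xs"
  shows "hamming_distance (map f xs) (map g xs) = card {x \<in> set xs. f x \<noteq> g x}"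
proof -
  have "{x \<in> set xs. f x \<noteq> g x} = (!) xs ` {i. i < length xs \<and> f (xs ! i) \<noteq> g (xs ! i)}"
    by (auto simp: in_set_conv_nth)
  moreover have "inj_on ((!) xs) {i. i < length xs \<and> f (xs ! i) \<noteq> g (xs ! i)}"
    using assms by (auto simp: inj_on_def nth_eq_iff_index_eq)
  ultimately have "card {x \<in> set xs. f x \<noteq> g x} =
      card {i. i < length xs \<and> f (xs ! i) \<noteq> g (xs ! i)}"
    by (simp add: card_image)
  also have "{i. i < length xs \<and> f (xs ! i) \<noteq> g (xs ! i)} =
      {i. i < length (map f xs) \<and> map f xs ! i \<noteq> map g xs ! i}"
    by auto
  finally show ?thesis
    by (simp add: hamming_distance_def)
qed

context curve_function_field
begin

lemma emb_0 [simp]: "emb 0 = 0"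
  using emb_add [of 0 0] by (metis add.right_neutral add_left_cancel)

lemma emb_minus: "emb (- a) = - emb a"
  using emb_add [of a "- a"] by (simp add: eq_neg_iff_add_eq_0 add.commute)

lemma emb_diff: "emb (a - b) = emb a - emb b"
  using emb_add [of a "- b"] by (simp add: emb_minus)

lemma emb_eq_0_iff [simp]: "emb a = 0 \<longleftrightarrow> a = 0"
proof
  assume "emb a = 0"
  then show "a = 0"
    using emb_mult [of a "inverse a"] emb_one by (cases "a = 0") auto
qed simp

lemma emb_sum: "emb (sum f A) = (\<Sum>x\<in>A. emb (f x))"
  by (induction A rule: infinite_finite_induct) (simp_all add: emb_add)

lemma emb_power: "emb (a ^ n) = emb a ^ n"
  by (induction n) (simp_all add: emb_mult emb_one)

lemma emb_of_nat: "emb (of_nat n) = of_nat n"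
  by (induction n) (simp_all add: emb_add emb_one)

section \<open>Arithmetic of a single valuation\<close>

context
  fixes P
  assumes P: "P \<in> points emb"
begin

lemma point_1: "P 1 = 0"
  using point_emb [OF P, of 1] by (simp add: emb_one)

lemma point_minus: "P (- f) = P f"
  using point_mult [OF P, of "emb (- 1)" f] point_emb [OF P, of "- 1"]
  by (cases "f = 0") (auto simp: emb_minus emb_one)

lemma point_power: "f \<noteq> 0 \<Longrightarrow> P (f ^ n) = int n * P f"
  by (induction n) (simp_all add: point_1 point_mult [OF P] algebra_simps)

lemma point_powi:
  assumes "f \<noteq> 0"
  shows "P (f powi i) = i * P f"
proof (cases "i \<ge> 0")
  case True
  then show ?thesis
    using assms by (simp add: power_int_def point_power)
next
  case False
  have "P (f powi i) + P (f powi (- i)) = P (f powi i * f powi (- i))"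
    using assms by (simp add: point_mult [OF P])
  also have "f powi i * f powi (- i) = 1"
    using assms by (simp add: power_int_minus)
  finally have "P (f powi i) = - P (f powi (- i))"
    by (simp add: point_1)
  also have "P (f powi (- i)) = (- i) * P f"
    using False assms by (simp add: power_int_def point_power)
  finally show ?thesis
    by simp
qed

lemma order_ge_add: "order_ge P n f \<Longrightarrow> order_ge P n g \<Longrightarrow> order_ge P n (f + g)"
  using point_add [OF P, of f g] by (fastforce simp: order_ge_def)

lemma order_ge_minus: "order_ge P n (- f) \<longleftrightarrow> order_ge P n f"
  by (simp add: order_ge_def point_minus)

lemma order_ge_diff: "order_ge P n f \<Longrightarrow> order_ge P n g \<Longrightarrow> order_ge P n (f - g)"
  using order_ge_add [of n f "- g"] by (simp add: order_ge_minus)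

lemma order_ge_sum: "(\<And>x. x \<in> A \<Longrightarrow> order_ge P n (f x)) \<Longrightarrow> order_ge P n (sum f A)"
  by (induction A rule: infinite_finite_induct) (simp_all add: order_ge_add)

lemma order_ge_mult_iff: "h \<noteq> 0 \<Longrightarrow> order_ge P n (f * h) \<longleftrightarrow> order_ge P (n - P h) f"
  by (cases "f = 0") (auto simp: order_ge_def point_mult [OF P])

lemma order_ge_emb: "n \<le> 0 \<Longrightarrow> order_ge P n (emb c)"
  using point_emb [OF P, of c] by (cases "c = 0") (auto simp: order_ge_def)

lemma order_ge_emb_pos: "n > 0 \<Longrightarrow> order_ge P n (emb c) \<longleftrightarrow> c = 0"
  using point_emb [OF P, of c] by (cases "c = 0") (auto simp: order_ge_def)

lemma order_ge_emb_powi: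
  assumes "t \<noteq> 0" "P t = 1"
  shows "order_ge P i (emb c * t powi i)"
  using order_ge_mult_iff [of "t powi i" i "emb c"] assms
  by (simp add: point_powi order_ge_emb)

text \<open>Two constants congruent to \<open>f\<close> differ by a constant of positive order,
  which can only be \<open>0\<close>.\<close>

lemma value_at_eqI:
  assumes "order_ge P 1 (f - emb c)"
  shows "value_at emb P f = c"
  unfolding value_at_def maximal_ideal_iff
proof (rule the_equality)
  fix d assume "order_ge P 1 (f - emb d)"
  from order_ge_diff [OF assms this] have "order_ge P 1 (emb (d - c))"
    by (simp add: emb_diff)
  then show "d = c"
    by (simp add: order_ge_emb_pos)
qed (fact assms)

end

section \<open>Values at a rational point\<close>

context
  fixes P
  assumes rational: "P \<in> rational_points emb"
begin

private lemma P: "P \<in> points emb"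
  using rational rational_points_subset by blast

lemma value_at:
  assumes "order_ge P 0 f"
  shows "order_ge P 1 (f - emb (value_at emb P f))"
proof -
  from rational assms obtain c where c: "order_ge P 1 (f - emb c)"
    unfolding rational_points_def local_ring_iff maximal_ideal_iff mem_Collect_eq Ball_def by blast
  with value_at_eqI [OF P c] show ?thesis
    by simp
qed

lemma value_at_eq_0_iff:
  assumes "order_ge P 0 f"
  shows "value_at emb P f = 0 \<longleftrightarrow> order_ge P 1 f"
  using value_at [OF assms] value_at_eqI [OF P, of f 0] by auto

lemma value_at_diff:
  assumes "order_ge P 0 f" "order_ge P 0 g"
  shows "value_at emb P (f - g) = value_at emb P f - value_at emb P g"
proof (rule value_at_eqI [OF P])
  show "order_ge P 1 (f - g - emb (value_at emb P f - value_at emb P g))"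
    using order_ge_diff [OF P value_at [OF assms(1)] value_at [OF assms(2)]]
    by (simp add: emb_diff algebra_simps)
qed

end

end

section \<open>Evaluation codes\<close>

context curve_function_field
begin

text \<open>Counting replaces dimension theory: the residue field is a copy of the finite field
  \<open>k\<close>, so a basis \<open>B\<close> yields \<open>|k| ^ card B = |k|\<close>. Existence
  is witnessed by \<open>{1}\<close>.\<close>

lemma point_degree_rational:
  assumes rational: "P \<in> rational_points emb" and "finite (UNIV :: 'k set)"
  shows "point_degree emb P = 1"
  unfolding point_degree_def
proof (rule the_equality)
  have P: "P \<in> points emb"
    using rational rational_points_subset by blast
  have one: "c \<in> {1} \<rightarrow>\<^sub>E UNIV \<and> f - (\<Sum>b\<in>{1}. emb (c b) * b) \<in> maximal_ideal P
      \<longleftrightarrow> c = (\<lambda>x\<in>{1}. value_at emb P f)" if "f \<in> local_ring P" for f c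
    using value_at [OF rational, of f] value_at_eqI [OF P, of f "c 1"] that
    by (auto simp: maximal_ideal_iff local_ring_iff PiE_def extensional_def fun_eq_iff)
  show "\<exists>B. residue_field_basis emb P B \<and> card B = 1"
  proof (intro exI conjI)
    show "residue_field_basis emb P {1}"
      unfolding residue_field_basis_def
    proof (intro conjI ballI)
      fix f assume "f \<in> local_ring P"
      show "\<exists>!c. c \<in> {1} \<rightarrow>\<^sub>E UNIV \<and> f - (\<Sum>b\<in>{1}. emb (c b) * b) \<in> maximal_ideal P"
        unfolding one [OF \<open>f \<in> local_ring P\<close>] by simp
    qed (simp_all add: local_ring_iff order_ge_def point_1 [OF P])
  qed simp
next
  fix d
  assume "\<exists>B. residue_field_basis emb P B \<and> card B = d"
  then obtain B where B: "residue_field_basis emb P B" and d: "card B = d"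
    by blast
  have P: "P \<in> points emb"
    using rational rational_points_subset by blast
  have fin: "finite B" and sub: "\<And>b. b \<in> B \<Longrightarrow> order_ge P 0 b"
    using B by (auto simp: residue_field_basis_def local_ring_iff)
  \<comment> \<open>The constant to which the combination with coefficients \<open>c\<close> reduces
    at \<open>P\<close>; the basis property says that \<open>r\<close> is a bijection onto
    \<open>k\<close>.\<close>
  define r where "r c = (\<Sum>b\<in>B. c b * value_at emb P b)" for c
  have r: "order_ge P 1 ((\<Sum>b\<in>B. emb (c b) * b) - emb (r c))" for c
  proof -
    have "(\<Sum>b\<in>B. emb (c b) * b) - emb (r c) =
        (\<Sum>b\<in>B. (b - emb (value_at emb P b)) * emb (c b))"
      by (simp add: r_def emb_sum emb_mult sum_subtractf algebra_simps)
    moreover have "order_ge P 1 ((b - emb (value_at emb P b)) * emb (c b))" if "b \<in> B" for b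
      using value_at [OF rational sub [OF that]] point_emb [OF P, of "c b"]
      by (cases "c b = 0") (simp_all add: order_ge_mult_iff [OF P])
    ultimately show ?thesis
      by (simp add: order_ge_sum [OF P])
  qed
  have r_iff: "emb a - (\<Sum>b\<in>B. emb (c b) * b) \<in> maximal_ideal P \<longleftrightarrow> r c = a" for a c
  proof -
    have "order_ge P 1 (emb a - (\<Sum>b\<in>B. emb (c b) * b)) \<longleftrightarrow> order_ge P 1 (emb (a - r c))"
      using order_ge_add [OF P r [of c], of "emb a - (\<Sum>b\<in>B. emb (c b) * b)"]
        order_ge_diff [OF P _ r [of c], of "emb (a - r c)"]
      by (auto simp: emb_diff algebra_simps)
    then show ?thesis
      by (auto simp: maximal_ideal_iff order_ge_emb_pos [OF P])
  qed
  have "\<exists>!c. c \<in> B \<rightarrow>\<^sub>E UNIV \<and> r c = a" for a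
  proof -
    have "emb a \<in> local_ring P"
      by (simp add: local_ring_iff order_ge_emb [OF P])
    then show ?thesis
      using B unfolding residue_field_basis_def r_iff [symmetric] by blast
  qed
  then have "bij_betw r (B \<rightarrow>\<^sub>E UNIV) UNIV"
    unfolding bij_betw_def inj_on_def by (metis UNIV_I UNIV_eq_I image_eqI)
  then have "card (B \<rightarrow>\<^sub>E (UNIV :: 'k set)) = card (UNIV :: 'k set)"
    by (rule bij_betw_same_card)
  then have "card (UNIV :: 'k set) ^ d = card (UNIV :: 'k set) ^ 1"
    using fin d by (simp add: card_PiE)
  moreover have "card (UNIV :: 'k set) > 1"
    using card_mono [OF assms(2), of "{0, 1}"] by simp
  ultimately show "d = 1"
    using power_inject_exp by blast
qed

lemma riemann_roch_space_diff:
  "f \<in> riemann_roch_space emb E \<Longrightarrow> g \<in> riemann_roch_space emb E \<Longrightarrow>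
     f - g \<in> riemann_roch_space emb E"
  by (simp add: riemann_roch_space_iff order_ge_diff)

lemma zero_in_riemann_roch_space: "0 \<in> riemann_roch_space emb E"
  by (simp add: riemann_roch_space_iff)

text \<open>
  The factor \<open>h P\<close> moves the leading coefficient of \<open>f \<in> L(D - C)\<close> at \<open>P\<close> to the constant term, so
  that both codes are of this shape: \<open>h = 1\<close> for \<open>C\<^sub>L\<close>, and \<open>h P = u t\<close> for
  \<open>C\<^sub>\<Omega>\<close>, where \<open>t\<close> is the uniformizer at \<open>P\<close> and \<open>u dt\<close> a differential with divisor \<open>K\<close>.
\<close>

lemma minimum_distance_evaluation_code:
  fixes C :: "'a divisor"
  assumes fin: "finite (UNIV :: 'k set)"
    and dist: "distinct Ps" and rational: "set Ps \<subseteq> rational_points emb"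
    and h: "\<And>P. P \<in> set Ps \<Longrightarrow> h P \<noteq> 0 \<and> P (h P) = 1 - Poly_Mapping.lookup C P"
  shows "minimum_distance ((\<lambda>f. map (\<lambda>P. value_at emb P (f * h P)) Ps) `
             riemann_roch_space emb (points_divisor Ps - C)) =
          Inf {enat (nat (divisor_degree emb A)) | A.
             is_divisor emb A \<and> divisor_le 0 A \<and> divisor_le A (points_divisor Ps) \<and>
             riemann_roch_space emb (A - C) \<noteq> riemann_roch_space emb (- C)}"
    (is "minimum_distance (?ev ` ?L (?D - C)) = Inf ?S")
proof -
  \<comment> \<open>The support of the word of \<open>f\<close>, kept as a set of points so that it
    can be compared with the support of \<open>A\<close>.\<close>
  define Z where "Z f = {P \<in> set Ps. value_at emb P (f * h P) \<noteq> 0}" for f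
  note rat = subsetD [OF rational]
  have pts: "P \<in> points emb" if "P \<in> set Ps" for P
    using rat [OF that] rational_points_subset by blast
  have order_iff: "order_ge P n (f * h P) \<longleftrightarrow> order_ge P (n - 1 + Poly_Mapping.lookup C P) f"
    if "P \<in> set Ps" for P n f
    using order_ge_mult_iff [OF pts [OF that], of "h P" n f] h [OF that] by (simp add: algebra_simps)
  have regular: "order_ge P 0 (f * h P)" if "P \<in> set Ps" "f \<in> ?L (?D - C)" for P f
    using that(2) [unfolded riemann_roch_space_iff, THEN bspec, OF pts [OF that(1)]] that(1)
    by (simp add: order_iff lookup_minus lookup_points_divisor dist)
  have dist_ev: "hamming_distance (?ev f) (?ev g) = card (Z (f - g))"
    if "f \<in> ?L (?D - C)" "g \<in> ?L (?D - C)" for f g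
    using that by (auto simp: hamming_distance_map [OF dist] Z_def left_diff_distrib
        value_at_diff rat regular intro!: arg_cong [where f = card])
  have ev_eq_iff: "?ev f = ?ev g \<longleftrightarrow> Z (f - g) = {}"
    if "f \<in> ?L (?D - C)" "g \<in> ?L (?D - C)" for f g
    using that by (auto simp: Z_def left_diff_distrib value_at_diff rat regular)
  \<comment> \<open>Membership in \<open>L(A - C)\<close> and in \<open>L(D - C)\<close> differ only
    at the points of \<open>D\<close> outside \<open>A\<close>. There the order must rise by one,
    and this extra unit is the vanishing of the coordinate.\<close>
  have sub_iff: "f \<in> ?L (A - C) \<longleftrightarrow> f \<in> ?L (?D - C) \<and> Z f \<subseteq> Poly_Mapping.keys A"
    if A: "divisor_le 0 A" "divisor_le A ?D" for A f
  proof -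
    have A01: "Poly_Mapping.lookup A P = (if P \<in> Poly_Mapping.keys A then 1 else 0)" for P
      using A [unfolded divisor_le_def, THEN spec, of P]
      by (auto simp: lookup_points_divisor dist in_keys_iff split: if_splits)
    have keys: "Poly_Mapping.keys A \<subseteq> set Ps"
    proof
      fix P assume "P \<in> Poly_Mapping.keys A"
      then show "P \<in> set Ps"
        using A(2) [unfolded divisor_le_def, THEN spec, of P] A01 [of P]
        by (simp add: lookup_points_divisor dist split: if_splits)
    qed
    have Z_iff: "P \<notin> Z f \<longleftrightarrow> order_ge P (Poly_Mapping.lookup C P) f"
      if "P \<in> set Ps" "f \<in> ?L (?D - C)" for P
      using that value_at_eq_0_iff [OF rat [OF that(1)] regular [OF that]]
      by (simp add: Z_def order_iff)
    have le: "?L (A - C) \<subseteq> ?L (?D - C)"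
      using A(2) unfolding riemann_roch_space_iff divisor_le_def lookup_minus subset_iff
      by (meson diff_right_mono neg_le_iff_le order_ge_mono)
    have "f \<in> ?L (A - C) \<longleftrightarrow> Z f \<subseteq> Poly_Mapping.keys A" if f: "f \<in> ?L (?D - C)"
    proof
      assume "f \<in> ?L (A - C)"
      show "Z f \<subseteq> Poly_Mapping.keys A"
      proof (rule subsetI, rule ccontr)
        fix P assume "P \<in> Z f" "P \<notin> Poly_Mapping.keys A"
        moreover from this have "P \<in> set Ps" by (simp add: Z_def)
        moreover have "order_ge P (Poly_Mapping.lookup C P) f"
          using \<open>f \<in> ?L (A - C)\<close> pts [OF \<open>P \<in> set Ps\<close>] \<open>P \<notin> Poly_Mapping.keys A\<close>
          by (auto simp: riemann_roch_space_iff lookup_minus in_keys_iff)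
        ultimately show False
          using Z_iff [OF _ f] by blast
      qed
    next
      assume Z: "Z f \<subseteq> Poly_Mapping.keys A"
      show "f \<in> ?L (A - C)"
        unfolding riemann_roch_space_iff
      proof
        fix P assume P: "P \<in> points emb"
        then have 1: "order_ge P (- Poly_Mapping.lookup (?D - C) P) f"
          using f by (simp add: riemann_roch_space_iff)
        show "order_ge P (- Poly_Mapping.lookup (A - C) P) f"
        proof (cases "P \<in> set Ps \<and> P \<notin> Poly_Mapping.keys A")
          case True
          then show ?thesis
            using Z Z_iff [of P] f A01 [of P] by (auto simp: lookup_minus)
        next
          case False
          then have "Poly_Mapping.lookup A P = Poly_Mapping.lookup ?D P"
            using A01 [of P] keys by (auto simp: lookup_points_divisor dist)
          with 1 show ?thesis
            by (simp add: lookup_minus)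
        qed
      qed
    qed
    with le show ?thesis
      by blast
  qed
  \<comment> \<open>The points of \<open>A\<close> lie in \<open>D\<close>, hence are rational of
    degree one, and they occur with multiplicity one.\<close>
  have degree: "divisor_degree emb A = int (card (Poly_Mapping.keys A))"
    and keys: "Poly_Mapping.keys A \<subseteq> set Ps"
    if A: "divisor_le 0 A" "divisor_le A ?D" for A
  proof -
    have *: "P \<in> set Ps \<and> Poly_Mapping.lookup A P = 1" if "P \<in> Poly_Mapping.keys A" for P
      using A [unfolded divisor_le_def, THEN spec, of P] that
      by (auto simp: lookup_points_divisor dist in_keys_iff split: if_splits)
    then show "Poly_Mapping.keys A \<subseteq> set Ps"
      by blast
    show "divisor_degree emb A = int (card (Poly_Mapping.keys A))"
      using * by (simp add: divisor_degree_def point_degree_rational [OF rat fin])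
  qed
  have zero: "f \<in> ?L (- C) \<longleftrightarrow> f \<in> ?L (?D - C) \<and> Z f = {}" for f
    using sub_iff [of 0 f] by (simp add: divisor_le_def lookup_points_divisor dist)
  show ?thesis
  proof (rule antisym)
    show "minimum_distance (?ev ` ?L (?D - C)) \<le> Inf ?S"
    proof (rule Inf_greatest, clarify)
      fix A
      assume A: "is_divisor emb A" "divisor_le 0 A" "divisor_le A ?D" "?L (A - C) \<noteq> ?L (- C)"
      have "?L (- C) \<subseteq> ?L (A - C)"
        using zero sub_iff [OF A(2,3)] by blast
      with A(4) obtain f where f: "f \<in> ?L (A - C)" "f \<notin> ?L (- C)"
        by blast
      then have f': "f \<in> ?L (?D - C)" "Z f \<subseteq> Poly_Mapping.keys A" "Z f \<noteq> {}"
        using sub_iff [OF A(2,3)] zero by auto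
      have "?ev f \<noteq> ?ev 0"
        using f' ev_eq_iff [OF f'(1) zero_in_riemann_roch_space] by simp
      then have "minimum_distance (?ev ` ?L (?D - C)) \<le> enat (hamming_distance (?ev f) (?ev 0))"
        unfolding minimum_distance_def
        using f'(1) zero_in_riemann_roch_space [of "?D - C"]
        by (intro Inf_lower) blast
      also have "\<dots> \<le> enat (nat (divisor_degree emb A))"
        using f' dist_ev [of f 0]
        by (simp add: zero_in_riemann_roch_space degree [OF A(2,3)] card_mono)
      finally show "minimum_distance (?ev ` ?L (?D - C)) \<le> enat (nat (divisor_degree emb A))" .
    qed
    \<comment> \<open>Each distance between two distinct words is the degree of an admissible
      \<open>A\<close>, namely the support of their difference. A code with a single word needs no
      separate case, as the inclusion then concerns the empty set.\<close>
    show "Inf ?S \<le> minimum_distance (?ev ` ?L (?D - C))"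
      unfolding minimum_distance_def
    proof (rule Inf_superset_mono, clarify)
      fix f g
      assume fg: "f \<in> ?L (?D - C)" "g \<in> ?L (?D - C)" "?ev f \<noteq> ?ev g"
      define A where "A = points_divisor (filter (\<lambda>P. P \<in> Z (f - g)) Ps)"
      have lookup: "Poly_Mapping.lookup A P = (if P \<in> Z (f - g) then 1 else 0)" for P
        by (auto simp: A_def lookup_points_divisor dist Z_def)
      then have keys_A: "Poly_Mapping.keys A = Z (f - g)"
        by (auto simp: in_keys_iff split: if_splits)
      have Z: "Z (f - g) \<subseteq> set Ps" "Z (f - g) \<noteq> {}"
        using fg ev_eq_iff by (auto simp: Z_def)
      have A: "divisor_le 0 A" "divisor_le A ?D"
        using Z by (auto simp: divisor_le_def lookup lookup_points_divisor dist)
      have "f - g \<in> ?L (?D - C)"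
        using fg riemann_roch_space_diff by blast
      then have "f - g \<in> ?L (A - C)" "f - g \<notin> ?L (- C)"
        using sub_iff [OF A] zero keys_A Z by auto
      moreover have "is_divisor emb A"
        using Z pts by (auto simp: is_divisor_def keys_A)
      moreover have "hamming_distance (?ev f) (?ev g) = nat (divisor_degree emb A)"
        using fg by (simp add: dist_ev degree [OF A] keys_A)
      ultimately show "\<exists>A. enat (hamming_distance (?ev f) (?ev g)) = enat (nat (divisor_degree emb A)) \<and>
          is_divisor emb A \<and> divisor_le 0 A \<and> divisor_le A ?D \<and> ?L (A - C) \<noteq> ?L (- C)"
        using A by metis
    qed
  qed
qed

end

section \<open>Laurent expansions at simple poles\<close>

context curve_function_field
begin

context
  fixes P t
  assumes P: "P \<in> points emb" and t: "t \<noteq> 0" "P t = 1"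
begin

lemma laurent_expansion_iff:
  "laurent_expansion emb P t f c \<longleftrightarrow>
     (\<exists>m. (\<forall>i<m. c i = 0) \<and>
       (\<forall>N\<ge>m. order_ge P (N + 1) (f - (\<Sum>i=m..N. emb (c i) * t powi i))))"
  by (simp add: laurent_expansion_def order_ge_def Let_def less_iff_succ_less_eq)

text \<open>Two expansions may start at different \<open>m\<close>; this lets both be summed from a
  common lower index. If \<open>N < m\<close>, the sum vanishes and \<open>f\<close> itself already
  has order at least \<open>m\<close>.\<close>

lemma laurent_expansion_lower_bound:
  assumes m: "\<forall>i<m. c i = 0"
    and exp: "\<forall>N\<ge>m. order_ge P (N + 1) (f - (\<Sum>i=m..N. emb (c i) * t powi i))"
    and "n \<le> m" "n \<le> N"
  shows "order_ge P (N + 1) (f - (\<Sum>i=n..N. emb (c i) * t powi i))"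
proof (cases "m \<le> N")
  case True
  have "(\<Sum>i=n..N. emb (c i) * t powi i) = (\<Sum>i=m..N. emb (c i) * t powi i)"
    using m \<open>n \<le> m\<close> by (intro sum.mono_neutral_right) auto
  with exp True show ?thesis
    by simp
next
  case False
  have "order_ge P (m + 1) (f - (\<Sum>i=m..m. emb (c i) * t powi i))"
    using exp by blast
  then have "order_ge P m (f - emb (c m) * t powi m)"
    by (auto intro: order_ge_mono)
  from order_ge_add [OF P this order_ge_emb_powi [OF P t, of m "c m"]] have "order_ge P m f"
    by simp
  then have "order_ge P (N + 1) f"
    using False by (auto intro: order_ge_mono)
  moreover have "(\<Sum>i=n..N. emb (c i) * t powi i) = 0"
    using m False by (intro sum.neutral) auto
  ultimately show ?thesis
    by simp
qed

text \<open>Once the coefficients agree below \<open>N\<close>, subtracting the truncations at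
  \<open>N\<close> leaves \<open>(c N - d N) t ^ N\<close> with order above \<open>N\<close>, so the
  constant \<open>c N - d N\<close> has positive order and vanishes.\<close>

lemma laurent_expansion_unique:
  assumes "laurent_expansion emb P t f c" "laurent_expansion emb P t f d"
  shows "c = d"
proof -
  from assms obtain m n where
    c: "\<forall>i<m. c i = 0" "\<forall>N\<ge>m. order_ge P (N + 1) (f - (\<Sum>i=m..N. emb (c i) * t powi i))" and
    d: "\<forall>i<n. d i = 0" "\<forall>N\<ge>n. order_ge P (N + 1) (f - (\<Sum>i=n..N. emb (d i) * t powi i))"
    unfolding laurent_expansion_iff by blast
  define l where "l = min m n"
  have "c (l + int j) = d (l + int j)" for j
  proof (induction j rule: less_induct)
    case (less j)
    define N where "N = l + int j"
    have eq: "c i = d i" if "i \<in> {l..<N}" for i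
      using less [of "nat (i - l)"] that by (auto simp: N_def nat_less_iff)
    have split: "{l..N} = insert N {l..<N}"
      by (auto simp: N_def)
    have "order_ge P (N + 1) (f - (\<Sum>i=l..N. emb (c i) * t powi i))"
         "order_ge P (N + 1) (f - (\<Sum>i=l..N. emb (d i) * t powi i))"
      using laurent_expansion_lower_bound [OF c, of l N]
        laurent_expansion_lower_bound [OF d, of l N] by (simp_all add: l_def N_def)
    from order_ge_diff [OF P this(2) this(1)]
    have "order_ge P (N + 1) (emb (c N - d N) * t powi N)"
      by (simp add: split eq emb_diff algebra_simps)
    then have "order_ge P 1 (emb (c N - d N))"
      using t by (simp add: order_ge_mult_iff [OF P] point_powi [OF P])
    then show ?case
      by (simp add: order_ge_emb_pos [OF P] N_def)
  qed
  note nonneg = this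
  have "c i = d i" if "i \<ge> l" for i
    using nonneg [of "nat (i - l)"] that by simp
  moreover have "c i = d i" if "i < l" for i
    using that c(1) d(1) by (simp add: l_def)
  ultimately show ?thesis
    by (intro ext) (metis linorder_not_less)
qed

lemma laurent_expansion_simple_pole:
  assumes rational: "P \<in> rational_points emb" and f: "order_ge P (- 1) f"
  shows "\<exists>c. laurent_expansion emb P t f c \<and> c (- 1) = value_at emb P (f * t)"
proof -
  \<comment> \<open>Successive approximation: \<open>r n\<close> is what remains of \<open>f\<close>
    after the exponents \<open>-1, ..., n - 2\<close>. It has order at least \<open>n - 1\<close>,
    so \<open>r n * t powi (1 - n)\<close> is regular and its value is the coefficient of
    \<open>t powi (n - 1)\<close>.\<close>
  define coef where "coef n r = value_at emb P (r * t powi (1 - int n))" for n r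
  define r where "r = rec_nat f (\<lambda>n r. r - emb (coef n r) * t powi (int n - 1))"
  have r_0: "r 0 = f" and r_Suc: "r (Suc n) = r n - emb (coef n (r n)) * t powi (int n - 1)" for n
    by (simp_all add: r_def)
  have t_nz: "t powi i \<noteq> 0" for i
    using t by simp
  have r: "order_ge P (int n - 1) (r n)" for n
  proof (induction n)
    case 0
    then show ?case
      using f by (simp add: r_0)
  next
    case (Suc n)
    have "order_ge P 0 (r n * t powi (1 - int n))"
      using Suc t by (simp add: order_ge_mult_iff [OF P t_nz] point_powi [OF P])
    from value_at [OF rational this]
    have "order_ge P 1 (r n * t powi (1 - int n) - emb (coef n (r n)))"
      by (simp add: coef_def)
    also have "r n * t powi (1 - int n) - emb (coef n (r n)) = r (Suc n) * t powi (1 - int n)"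
      using t power_int_add [of t "int n - 1" "1 - int n"]
      by (simp add: r_Suc left_diff_distrib mult.assoc)
    finally show ?case
      using t by (simp add: order_ge_mult_iff [OF P t_nz] point_powi [OF P])
  qed
  \<comment> \<open>The coefficient of exponent \<open>i\<close> is found at stage
    \<open>i + 1\<close>, as the expansion starts at \<open>-1\<close>.\<close>
  define c where "c i = (if i < - 1 then 0 else coef (nat (i + 1)) (r (nat (i + 1))))" for i
  have "f - (\<Sum>i = - 1..int n - 1. emb (c i) * t powi i) = r (Suc n)" for n
  proof (induction n)
    case 0
    then show ?case
      by (simp add: r_Suc r_0 c_def)
  next
    case (Suc n)
    have "{- 1..int (Suc n) - 1} = insert (int n) {- 1..int n - 1}"
      by auto
    with Suc show ?case
      by (simp add: r_Suc [of "Suc n"] c_def nat_add_distrib algebra_simps)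
  qed
  note partial = this
  have "order_ge P (N + 1) (f - (\<Sum>i = - 1..N. emb (c i) * t powi i))" if "N \<ge> - 1" for N
    using r [of "Suc (nat (N + 1))"] partial [of "nat (N + 1)"] that
    by (simp add: add.commute [of 1])
  then have "laurent_expansion emb P t f c"
    unfolding laurent_expansion_iff by (intro exI [of _ "- 1"]) (auto simp: c_def)
  moreover have "c (- 1) = value_at emb P (f * t)"
    by (simp add: c_def coef_def r_0)
  ultimately show ?thesis
    by blast
qed

end

text \<open>Turns residues into evaluations: by uniqueness the expansion described by
  \<open>THE\<close> is the constructed one, whose first coefficient is a value.\<close>

lemma residue_at_simple_pole:
  assumes rational: "P \<in> rational_points emb"
    and "order_ge P (- 1) (local_coefficient emb P \<omega>)"
  shows "residue_at emb P \<omega> = value_at emb P (local_coefficient emb P \<omega> * uniformizer P)"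
proof -
  have P: "P \<in> points emb"
    using rational rational_points_subset by blast
  note t = uniformizer [OF P]
  obtain c where c: "laurent_expansion emb P (uniformizer P) (local_coefficient emb P \<omega>) c"
    "c (- 1) = value_at emb P (local_coefficient emb P \<omega> * uniformizer P)"
    using laurent_expansion_simple_pole [OF P t assms] by blast
  have "(THE c. laurent_expansion emb P (uniformizer P) (local_coefficient emb P \<omega>) c) = c"
    using c(1) laurent_expansion_unique [OF P t] by blast
  with c(2) show ?thesis
    by (simp add: residue_at_def)
qed

end

section \<open>Linear systems over subfields\<close>

text \<open>Closure under \<open>x / y\<close> includes \<open>y = 0\<close>, where the quotient is
  \<open>0\<close>. Zero and negatives come from closure under differences.\<close>

definition is_subfield :: "'a::field set \<Rightarrow> bool" where
  "is_subfield K \<longleftrightarrow> 1 \<in> K \<and> (\<forall>x\<in>K. \<forall>y\<in>K. x - y \<in> K \<and> x * y \<in> K \<and> x / y \<in> K)"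

context
  fixes K :: "'a::field set"
  assumes K: "is_subfield K"
begin

lemma subfield_1: "1 \<in> K"
  and subfield_diff: "x \<in> K \<Longrightarrow> y \<in> K \<Longrightarrow> x - y \<in> K"
  and subfield_mult: "x \<in> K \<Longrightarrow> y \<in> K \<Longrightarrow> x * y \<in> K"
  and subfield_divide: "x \<in> K \<Longrightarrow> y \<in> K \<Longrightarrow> x / y \<in> K"
  using K by (auto simp: is_subfield_def)

lemma subfield_0: "0 \<in> K"
  using subfield_diff [OF subfield_1 subfield_1] by simp

lemma subfield_minus: "x \<in> K \<Longrightarrow> - x \<in> K"
  using subfield_diff [OF subfield_0, of x] by simp

lemma subfield_add: "x \<in> K \<Longrightarrow> y \<in> K \<Longrightarrow> x + y \<in> K"
  using subfield_diff [of x "- y"] subfield_minus [of y] by simp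

lemma subfield_sum: "(\<And>x. x \<in> A \<Longrightarrow> f x \<in> K) \<Longrightarrow> sum f A \<in> K"
  by (induction A rule: infinite_finite_induct) (auto intro: subfield_0 subfield_add)

text \<open>Gaussian elimination by induction on the equations. It uses only field operations, so
  the solution stays in the subfield \<open>K\<close>, which will be
  \<open>k(x) ^ p\<close>.\<close>

lemma homogeneous_system_solution:
  assumes "finite J" "finite I" "card J < card I" "\<And>i j. i \<in> I \<Longrightarrow> j \<in> J \<Longrightarrow> a i j \<in> K"
  shows "\<exists>c. (\<forall>i\<in>I. c i \<in> K) \<and> (\<exists>i\<in>I. c i \<noteq> 0) \<and> (\<forall>j\<in>J. (\<Sum>i\<in>I. c i * a i j) = 0)"
  using assms
proof (induction J arbitrary: I a rule: finite_induct)
  case empty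
  then have "I \<noteq> {}"
    by auto
  then show ?case
    by (intro exI [of _ "\<lambda>_. 1"]) (auto intro: subfield_1)
next
  case (insert j J)
  show ?case
  proof (cases "\<forall>i\<in>I. a i j = 0")
    case True
    then show ?thesis
      using insert.IH [of I a] insert.prems insert.hyps by auto
  next
    case False
    then obtain i0 where i0: "i0 \<in> I" "a i0 j \<noteq> 0"
      by blast
    \<comment> \<open>Equation \<open>j\<close> expresses the unknown at \<open>i0\<close> through
      the others; substituting this into the remaining equations gives the coefficients
      \<open>a'\<close>.\<close>
    define a' where "a' i l = a i l - a i j / a i0 j * a i0 l" for i l
    have "\<exists>c. (\<forall>i\<in>I - {i0}. c i \<in> K) \<and> (\<exists>i\<in>I - {i0}. c i \<noteq> 0) \<and>
        (\<forall>l\<in>J. (\<Sum>i\<in>I - {i0}. c i * a' i l) = 0)"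
      using insert.prems insert.hyps i0
      by (intro insert.IH) (auto simp: a'_def intro!: subfield_diff subfield_mult subfield_divide)
    then obtain c where c: "\<forall>i\<in>I - {i0}. c i \<in> K" "\<exists>i\<in>I - {i0}. c i \<noteq> 0"
      "\<forall>l\<in>J. (\<Sum>i\<in>I - {i0}. c i * a' i l) = 0"
      by blast
    define e where "e = - (\<Sum>i\<in>I - {i0}. c i * (a i j / a i0 j))"
    have sum: "(\<Sum>i\<in>I. (c(i0 := e)) i * a i l) = e * a i0 l + (\<Sum>i\<in>I - {i0}. c i * a i l)" for l
      using i0 insert.prems by (simp add: sum.remove [of I i0])
    have "(\<Sum>i\<in>I. (c(i0 := e)) i * a i l) = 0" if "l \<in> insert j J" for l
    proof (cases "l = j")
      case True
      then show ?thesis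
        unfolding sum using i0 by (simp add: e_def sum_distrib_right)
    next
      case False
      have "(\<Sum>i\<in>I. (c(i0 := e)) i * a i l) = (\<Sum>i\<in>I - {i0}. c i * a' i l)"
        unfolding sum
        by (simp add: e_def a'_def sum_distrib_right sum_subtractf right_diff_distrib mult.assoc)
      with c False that show ?thesis
        by simp
    qed
    moreover have "e \<in> K"
      unfolding e_def using c i0 insert.prems
      by (intro subfield_minus subfield_sum subfield_mult subfield_divide) auto
    ultimately show ?thesis
      using c by (intro exI [of _ "c(i0 := e)"]) auto
  qed
qed

text \<open>Reduction modulo \<open>X ^ p - t ^ p\<close>, a polynomial whose derivative vanishes in characteristic \<open>p\<close>.\<close>

lemma poly_power_reduction:
  assumes p: "p > 0" "of_nat p = (0 :: 'a)" and t: "t ^ p \<in> K" and f: "\<And>n. coeff f n \<in> K"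
  shows "\<exists>s. (\<forall>l<p. s l \<in> K) \<and> poly f t = (\<Sum>l<p. s l * t ^ l) \<and>
    poly (pderiv f) t = (\<Sum>l<p. of_nat l * s l * t ^ (l - 1))"
  using f
proof (induction f)
  case 0
  show ?case
    by (intro exI [of _ "\<lambda>_. 0"]) (simp add: subfield_0)
next
  case (pCons a f)
  obtain q where q: "p = Suc q"
    using p by (cases p) auto
  have "coeff f n \<in> K" for n
    using pCons.prems [of "Suc n"] by simp
  with pCons.IH obtain s where s: "\<forall>l<p. s l \<in> K" "poly f t = (\<Sum>l<p. s l * t ^ l)"
    "poly (pderiv f) t = (\<Sum>l<p. of_nat l * s l * t ^ (l - 1))"
    by blast
  \<comment> \<open>Multiplication by \<open>t\<close> shifts the exponents; the top term
    \<open>s q * t ^ p\<close> wraps around to the constant term because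
    \<open>t ^ p \<in> K\<close>.\<close>
  define s' where "s' l = (case l of 0 \<Rightarrow> a + s q * t ^ p | Suc l \<Rightarrow> s l)" for l
  have "s' l \<in> K" if "l < p" for l
    using that s t pCons.prems [of 0]
    by (auto simp: s'_def q split: nat.split intro!: subfield_add subfield_mult)
  moreover have "poly (pCons a f) t = (\<Sum>l<p. s' l * t ^ l)"
  proof -
    have "(\<Sum>l<p. s' l * t ^ l) = a + s q * t ^ p + (\<Sum>l<q. s l * t ^ Suc l)"
      unfolding q by (simp add: sum.lessThan_Suc_shift s'_def q del: sum.lessThan_Suc)
    also have "\<dots> = a + t * (\<Sum>l<p. s l * t ^ l)"
      by (simp add: q sum_distrib_left algebra_simps)
    finally show ?thesis
      by (simp add: s)
  qed
  moreover have "poly (pderiv (pCons a f)) t = (\<Sum>l<p. of_nat l * s' l * t ^ (l - 1))"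
  proof -
    have shift: "t * (of_nat l * s l * t ^ (l - 1)) = of_nat l * s l * t ^ l" for l
      by (cases l) (simp_all add: algebra_simps)
    have "poly (pderiv (pCons a f)) t =
        (\<Sum>l<p. s l * t ^ l) + (\<Sum>l<p. t * (of_nat l * s l * t ^ (l - 1)))"
      by (simp add: pderiv_pCons s sum_distrib_left)
    also have "\<dots> = (\<Sum>l<p. of_nat (Suc l) * s l * t ^ l)"
      unfolding shift sum.distrib [symmetric] by (simp add: algebra_simps)
    \<comment> \<open>The summand at \<open>l = q\<close> has the factor
      \<open>of_nat p = 0\<close>, so the wrapped term contributes nothing to the
      derivative.\<close>
    also have "\<dots> = (\<Sum>l<q. of_nat (Suc l) * s l * t ^ l)"
      using p(2) by (simp add: q)
    also have "\<dots> = (\<Sum>l<p. of_nat l * s' l * t ^ (l - 1))"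
      unfolding q by (simp add: sum.lessThan_Suc_shift s'_def del: sum.lessThan_Suc)
    finally show ?thesis .
  qed
  ultimately show ?case
    by (intro exI [of _ s']) blast
qed

end

text \<open>Evaluation at \<open>x\<close> along \<open>emb\<close> is a ring homomorphism
  \<open>ev\<close>, and the fractions of its image form a field.\<close>

lemma (in curve_function_field) is_subfield_rational_functions_in:
  "is_subfield (rational_functions_in emb x)"
proof -
  define ev where "ev p = poly (map_poly emb p) x" for p
  have pCons: "ev (pCons a p) = emb a + x * ev p" for a p
    by (simp add: ev_def map_poly_pCons)
  have ev_0: "ev 0 = 0"
    by (simp add: ev_def)
  have add: "ev (p + q) = ev p + ev q" for p q
    by (induction p q rule: poly_induct2) (simp_all add: pCons ev_0 emb_add algebra_simps)
  have minus: "ev (- p) = - ev p" for p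
    using add [of p "- p"] by (simp add: ev_0 eq_neg_iff_add_eq_0 add.commute)
  have diff: "ev (p - q) = ev p - ev q" for p q
    using add [of p "- q"] by (simp add: minus)
  have smult: "ev (smult a p) = emb a * ev p" for a p
    by (induction p) (simp_all add: pCons ev_0 emb_mult algebra_simps)
  have mult: "ev (p * q) = ev p * ev q" for p q
    by (induction p) (simp_all add: pCons ev_0 add smult algebra_simps)
  have one: "ev 1 = 1"
    by (simp add: one_pCons pCons ev_0 emb_one)
  have K: "rational_functions_in emb x = {ev p / ev q | p q. ev q \<noteq> 0}"
    by (simp add: rational_functions_in_def ev_def)
  show ?thesis
    unfolding is_subfield_def
  proof (intro conjI ballI)
    show "1 \<in> rational_functions_in emb x"
      unfolding K using one by (auto intro!: exI [of _ 1])
    fix f g assume "f \<in> rational_functions_in emb x" "g \<in> rational_functions_in emb x"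
    then obtain p q p' q' where f: "f = ev p / ev q" "ev q \<noteq> 0" and g: "g = ev p' / ev q'" "ev q' \<noteq> 0"
      unfolding K by blast
    have "f - g = ev (p * q' - p' * q) / ev (q * q')" "f * g = ev (p * p') / ev (q * q')"
      using f(2) g(2) by (simp_all add: f(1) g(1) mult diff field_simps)
    moreover have "ev (q * q') \<noteq> 0"
      using f g by (simp add: mult)
    ultimately show "f - g \<in> rational_functions_in emb x" "f * g \<in> rational_functions_in emb x"
      unfolding K by blast+
    show "f / g \<in> rational_functions_in emb x"
    proof (cases "ev p' = 0")
      case True
      then have "f / g = ev 0 / ev 1"
        using g by (simp add: ev_0)
      then show ?thesis
        unfolding K using one zero_neq_one by (metis (mono_tags, lifting) mem_Collect_eq)
    next
      case False
      then have "f / g = ev (p * q') / ev (q * p')" "ev (q * p') \<noteq> 0"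
        using f(2) g(2) by (simp_all add: f(1) g(1) mult)
      then show ?thesis
        unfolding K by blast
    qed
  qed
qed

section \<open>The degree of a function field over its Frobenius image\<close>

locale finite_curve_function_field = curve_function_field emb
  for emb :: "'k::{field,finite} \<Rightarrow> 'a::field" +
  fixes p :: nat
  assumes p_def: "p = CHAR('a)"
begin

text \<open>\<open>F\<close> inherits its characteristic from the finite field \<open>k\<close>,
  where it is positive and therefore prime.\<close>

lemma prime_p: "prime p"
proof -
  have "CHAR('a) = CHAR('k)"
    by (rule CHAR_eqI) (simp_all flip: emb_of_nat add: of_nat_eq_0_iff_char_dvd)
  then show ?thesis
    using prime_CHAR_semidom [OF finite_imp_CHAR_pos [where 'a = 'k]] by (simp add: p_def)
qed

lemma of_nat_p: "of_nat p = (0 :: 'a)"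
  by (simp add: p_def)

lemma p_pos: "p > 0"
  using prime_p prime_gt_0_nat by blast

lemma frobenius_add: "(x + y :: 'a) ^ p = x ^ p + y ^ p"
  by (rule freshmans_dream [OF _ p_def]) (use prime_p p_def in simp)

lemma frobenius_diff: "(x - y :: 'a) ^ p = x ^ p - y ^ p"
  using frobenius_add [of "x - y" y] by simp

lemma frobenius_sum: "(\<Sum>x\<in>A. f x :: 'a) ^ p = (\<Sum>x\<in>A. f x ^ p)"
  using p_pos by (induction A rule: infinite_finite_induct) (simp_all add: frobenius_add)

lemma is_subfield_frobenius_image:
  assumes "is_subfield (K :: 'a set)"
  shows "is_subfield ((\<lambda>z. z ^ p) ` K)"
  unfolding is_subfield_def
proof (intro conjI ballI)
  show "1 \<in> (\<lambda>z. z ^ p) ` K"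
    using subfield_1 [OF assms] by (auto intro!: image_eqI [of _ _ 1])
  fix x y assume "x \<in> (\<lambda>z. z ^ p) ` K" "y \<in> (\<lambda>z. z ^ p) ` K"
  then show "x - y \<in> (\<lambda>z. z ^ p) ` K" "x * y \<in> (\<lambda>z. z ^ p) ` K" "x / y \<in> (\<lambda>z. z ^ p) ` K"
    by (auto simp flip: frobenius_diff power_mult_distrib power_divide
        intro!: imageI subfield_diff [OF assms] subfield_mult [OF assms] subfield_divide [OF assms])
qed

text \<open>Finite fields are perfect: Frobenius is injective on \<open>k\<close>, hence
  surjective.\<close>

lemma emb_eq_frobenius: "\<exists>d. emb c = emb d ^ p"
proof -
  have "inj (\<lambda>d :: 'k. d ^ p)"
  proof (rule injI)
    fix c d :: 'k assume "c ^ p = d ^ p"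
    then have "emb (c - d) ^ p = 0"
      by (simp add: emb_diff frobenius_diff flip: emb_power)
    then show "c = d"
      by (simp add: p_pos)
  qed
  then have "surj (\<lambda>d :: 'k. d ^ p)"
    by (simp add: finite_UNIV_inj_surj)
  then obtain d where "c = d ^ p"
    by blast
  then show ?thesis
    by (auto simp: emb_power)
qed

section \<open>Spanning \<open>F\<close> over \<open>k(x)\<close> and over
  \<open>k(x) ^ p\<close>\<close>

lemma emb_in_rational_functions: "emb c \<in> rational_functions_in emb x"
  unfolding rational_functions_in_def mem_Collect_eq
  by (intro exI [of _ "[:c:]"] exI [of _ 1]) (simp add: map_poly_pCons emb_one)

lemma variable_in_rational_functions: "x \<in> rational_functions_in emb x"
  unfolding rational_functions_in_def mem_Collect_eq
  by (intro exI [of _ "[:0, 1:]"] exI [of _ 1]) (simp add: map_poly_pCons emb_one)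

text \<open>A spanning set of least cardinality is independent, since a nontrivial relation would
  make one of its members redundant.\<close>

lemma ex_basis_over_rational_functions:
  "\<exists>x B. finite B \<and>
    (\<forall>f. \<exists>c. (\<forall>b\<in>B. c b \<in> rational_functions_in emb x) \<and> f = (\<Sum>b\<in>B. c b * b)) \<and>
    (\<forall>c. (\<forall>b\<in>B. c b \<in> rational_functions_in emb x) \<longrightarrow> (\<Sum>b\<in>B. c b * b) = 0 \<longrightarrow>
      (\<forall>b\<in>B. c b = 0))"
proof -
  from one_variable obtain x where
    ex: "\<exists>B. finite B \<and>
      (\<forall>f. \<exists>c. (\<forall>b\<in>B. c b \<in> rational_functions_in emb x) \<and> f = (\<Sum>b\<in>B. c b * b))"
    by blast
  define spanning where "spanning B \<longleftrightarrow> finite B \<and>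
    (\<forall>f. \<exists>c. (\<forall>b\<in>B. c b \<in> rational_functions_in emb x) \<and> f = (\<Sum>b\<in>B. c b * b))" for B
  obtain B where B: "spanning B" and min: "\<And>B'. spanning B' \<Longrightarrow> card B \<le> card B'"
    using ex ex_has_least_nat [of spanning _ card] unfolding spanning_def [symmetric] by blast
  note K = is_subfield_rational_functions_in [of x]
  have fin: "finite B"
    using B by (simp add: spanning_def)
  have "\<forall>b\<in>B. r b = 0"
    if r: "\<forall>b\<in>B. r b \<in> rational_functions_in emb x" "(\<Sum>b\<in>B. r b * b) = 0" for r
  proof (rule ccontr)
    assume "\<not> (\<forall>b\<in>B. r b = 0)"
    then obtain b0 where b0: "b0 \<in> B" "r b0 \<noteq> 0"
      by blast
    have "spanning (B - {b0})"
      unfolding spanning_def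
    proof (intro conjI allI)
      fix f
      obtain c where c: "\<forall>b\<in>B. c b \<in> rational_functions_in emb x" "f = (\<Sum>b\<in>B. c b * b)"
        using B unfolding spanning_def by blast
      define c' where "c' b = c b - c b0 / r b0 * r b" for b
      have "\<forall>b\<in>B - {b0}. c' b \<in> rational_functions_in emb x"
        using b0 c r
        by (auto simp: c'_def intro!: subfield_diff [OF K] subfield_mult [OF K] subfield_divide [OF K])
      moreover have "f = (\<Sum>b\<in>B - {b0}. c' b * b)"
      proof -
        have "f = (\<Sum>b\<in>B. c b * b) - c b0 / r b0 * (\<Sum>b\<in>B. r b * b)"
          using r c by simp
        also have "\<dots> = (\<Sum>b\<in>B. c' b * b)"
          by (simp add: c'_def sum_distrib_left sum_subtractf left_diff_distrib mult.assoc)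
        also have "\<dots> = (\<Sum>b\<in>B - {b0}. c' b * b)"
          using b0 fin by (simp add: sum.remove [of B b0]) (simp add: c'_def)
        finally show ?thesis .
      qed
      ultimately show "\<exists>c. (\<forall>b\<in>B - {b0}. c b \<in> rational_functions_in emb x) \<and>
          f = (\<Sum>b\<in>B - {b0}. c b * b)"
        by blast
    qed (use fin in simp)
    from min [OF this] show False
      using b0 fin by (metis card_Diff1_less linorder_not_le)
  qed
  with B show ?thesis
    unfolding spanning_def by blast
qed

text \<open>Write \<open>f / g = f g ^ (p - 1) / g ^ p\<close>. The denominator is a
  \<open>p\<close>-th power, the numerator has coefficients in \<open>k = k ^ p\<close>, and its
  exponents can be reduced below \<open>p\<close> since \<open>x ^ p\<close> is a
  \<open>p\<close>-th power too.\<close>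

lemma rational_function_frobenius_decomposition:
  assumes "r \<in> rational_functions_in emb x"
  shows "\<exists>s. (\<forall>l<p. s l \<in> (\<lambda>z. z ^ p) ` rational_functions_in emb x) \<and> r = (\<Sum>l<p. s l * x ^ l)"
proof -
  let ?K = "rational_functions_in emb x" and ?K' = "(\<lambda>z. z ^ p) ` rational_functions_in emb x"
  note K = is_subfield_rational_functions_in [of x]
  note K' = is_subfield_frobenius_image [OF K]
  obtain f g where r: "r = poly (map_poly emb f) x / poly (map_poly emb g) x"
    and g: "poly (map_poly emb g) x \<noteq> 0"
    using assms unfolding rational_functions_in_def by blast
  define u where "u = poly (map_poly emb f) x"
  define v where "v = poly (map_poly emb g) x"
  have emb_K': "emb c \<in> ?K'" for c
    using emb_eq_frobenius [of c] emb_in_rational_functions by blast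
  have coeffs: "coeff (map_poly emb h) n \<in> ?K'" for h n
    by (simp add: coeff_map_poly emb_K')
  have "v \<in> ?K"
    unfolding v_def rational_functions_in_def mem_Collect_eq
    by (intro exI [of _ g] exI [of _ 1]) (simp add: map_poly_pCons one_pCons emb_one)
  then have v: "v ^ p \<in> ?K'"
    by blast
  have "coeff (map_poly emb f * map_poly emb g ^ (p - 1)) n \<in> ?K'" for n
  proof -
    have mult: "coeff (h1 * h2) n \<in> ?K'"
      if "\<And>n. coeff h1 n \<in> ?K'" "\<And>n. coeff h2 n \<in> ?K'" for h1 h2 n
      unfolding coeff_mult using that by (intro subfield_sum [OF K'] subfield_mult [OF K'])
    have "coeff (map_poly emb g ^ k) n \<in> ?K'" for k n
    proof (induction k arbitrary: n)
      case 0
      then show ?case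
        using subfield_0 [OF K'] subfield_1 [OF K'] by (simp add: coeff_1)
    next
      case (Suc k)
      then show ?case
        unfolding power_Suc using mult coeffs by blast
    qed
    then show ?thesis
      using mult coeffs by blast
  qed
  then obtain s where s: "\<forall>l<p. s l \<in> ?K'"
      "poly (map_poly emb f * map_poly emb g ^ (p - 1)) x = (\<Sum>l<p. s l * x ^ l)"
    using poly_power_reduction [OF K' p_pos of_nat_p, of x "map_poly emb f * map_poly emb g ^ (p - 1)"]
      variable_in_rational_functions [of x] by blast
  have "r = u * v ^ (p - 1) / v ^ p"
    using g p_pos power_Suc [of v "p - 1"] by (simp add: r u_def v_def)
  also have "\<dots> = (\<Sum>l<p. s l / v ^ p * x ^ l)"
    using s(2) by (simp add: u_def v_def sum_divide_distrib)
  finally have "r = (\<Sum>l<p. s l / v ^ p * x ^ l)" .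
  moreover have "\<forall>l<p. s l / v ^ p \<in> ?K'"
    using s v by (auto intro: subfield_divide [OF K'])
  ultimately show ?thesis
    by (intro exI [of _ "\<lambda>l. s l / v ^ p"]) blast
qed

text \<open>
  This says that the degree of \<open>F\<close> over its subfield \<open>F ^ p\<close> is at most \<open>p\<close>. If \<open>m = [F : k(x)]\<close>,
  then \<open>F ^ p\<close> has degree \<open>m\<close> and \<open>F\<close> has degree \<open>m p\<close> over \<open>k(x) ^ p = k(x ^ p)\<close>.
\<close>

lemma frobenius_dependent:
  fixes y :: "nat \<Rightarrow> 'a"
  shows "\<exists>c. (\<exists>i\<le>p. c i \<noteq> 0) \<and> (\<Sum>i\<le>p. c i ^ p * y i) = 0"
proof -
  from ex_basis_over_rational_functions obtain x B where fin: "finite B"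
    and span: "\<forall>f. \<exists>c. (\<forall>b\<in>B. c b \<in> rational_functions_in emb x) \<and> f = (\<Sum>b\<in>B. c b * b)"
    and indep: "\<forall>c. (\<forall>b\<in>B. c b \<in> rational_functions_in emb x) \<longrightarrow>
      (\<Sum>b\<in>B. c b * b) = 0 \<longrightarrow> (\<forall>b\<in>B. c b = 0)"
    by blast
  let ?K = "rational_functions_in emb x" and ?K' = "(\<lambda>z. z ^ p) ` rational_functions_in emb x"
  note K = is_subfield_rational_functions_in [of x]
  note K' = is_subfield_frobenius_image [OF K]
  have "\<exists>a. (\<forall>b\<in>B. \<forall>l<p. a b l \<in> ?K') \<and> f = (\<Sum>(b, l)\<in>B \<times> {..<p}. a b l * (x ^ l * b))"
    (is "?decomposed f") for f
  proof -
    obtain c where c: "\<forall>b\<in>B. c b \<in> ?K" "f = (\<Sum>b\<in>B. c b * b)"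
      using span by blast
    have "\<forall>b\<in>B. \<exists>s. (\<forall>l<p. s l \<in> ?K') \<and> c b = (\<Sum>l<p. s l * x ^ l)"
      using c(1) rational_function_frobenius_decomposition by blast
    from bchoice [OF this]
    obtain a where a: "\<forall>b\<in>B. (\<forall>l<p. a b l \<in> ?K') \<and> c b = (\<Sum>l<p. a b l * x ^ l)"
      by blast
    have "f = (\<Sum>b\<in>B. \<Sum>l<p. a b l * (x ^ l * b))"
      using a by (simp add: c(2) sum_distrib_right mult.assoc)
    with a show ?thesis
      by (intro exI [of _ a]) (simp add: sum.cartesian_product)
  qed
  then have "\<forall>f. ?decomposed f" ..
  from choice [OF this] obtain a where
    "\<forall>f. (\<forall>b\<in>B. \<forall>l<p. a f b l \<in> ?K') \<and>
      f = (\<Sum>(b, l)\<in>B \<times> {..<p}. a f b l * (x ^ l * b))"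
    by (rule exE)
  then have a: "\<And>f b l. b \<in> B \<Longrightarrow> l < p \<Longrightarrow> a f b l \<in> ?K'"
    and a_eq: "\<And>f. f = (\<Sum>(b, l)\<in>B \<times> {..<p}. a f b l * (x ^ l * b))"
    by blast+
  \<comment> \<open>For fixed \<open>i\<close>, the combination of the \<open>v (b, i)\<close> with
    coefficients \<open>r (b, i) ^ p\<close> is a \<open>p\<close>-th power times
    \<open>y i\<close>. There are \<open>card B * (p + 1)\<close> vectors \<open>v (b, i)\<close>,
    but only \<open>card B * p\<close> generators \<open>x ^ l * b\<close>.\<close>
  define v where "v = (\<lambda>(b, i). b ^ p * y i)"
  have "B \<noteq> {}"
    using span [THEN spec, of 1] by auto
  then have card: "card (B \<times> {..<p}) < card (B \<times> {..p})"
    using fin by (simp add: card_cartesian_product card_gt_0_iff)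
  have "\<exists>c. (\<forall>i\<in>B \<times> {..p}. c i \<in> ?K') \<and> (\<exists>i\<in>B \<times> {..p}. c i \<noteq> 0) \<and>
    (\<forall>j\<in>B \<times> {..<p}. (\<Sum>i\<in>B \<times> {..p}. c i * a (v i) (fst j) (snd j)) = 0)"
  proof (rule homogeneous_system_solution [OF K' _ _ card])
    show "a (v i) (fst j) (snd j) \<in> ?K'" if "j \<in> B \<times> {..<p}" for i j
      using that a [of "fst j" "snd j" "v i"] by auto
  qed (use fin in simp_all)
  then obtain c where c: "\<forall>i\<in>B \<times> {..p}. c i \<in> ?K'" "\<exists>i\<in>B \<times> {..p}. c i \<noteq> 0"
    "\<forall>j\<in>B \<times> {..<p}. (\<Sum>i\<in>B \<times> {..p}. c i * a (v i) (fst j) (snd j)) = 0"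
    by (elim exE conjE)
  from c(1) have "\<forall>i\<in>B \<times> {..p}. \<exists>r. r \<in> ?K \<and> c i = r ^ p"
    by blast
  from bchoice [OF this] obtain r where
    r: "\<forall>i\<in>B \<times> {..p}. r i \<in> ?K \<and> c i = r i ^ p"
    by (rule exE)
  define e where "e i = (\<Sum>b\<in>B. r (b, i) * b)" for i
  have "(\<Sum>i\<le>p. e i ^ p * y i) = (\<Sum>i\<le>p. \<Sum>b\<in>B. c (b, i) * v (b, i))"
    using r by (simp add: e_def v_def frobenius_sum sum_distrib_right
        power_mult_distrib mult.assoc)
  also have "\<dots> = (\<Sum>i\<in>B \<times> {..p}. c i * v i)"
    by (subst sum.swap) (simp add: sum.cartesian_product case_prod_unfold)
  also have "\<dots> = (\<Sum>i\<in>B \<times> {..p}. c i * (\<Sum>(b, l)\<in>B \<times> {..<p}. a (v i) b l * (x ^ l * b)))"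
    by (intro sum.cong refl arg_cong [where f = "(*) _"] a_eq)
  also have "\<dots> = (\<Sum>j\<in>B \<times> {..<p}. (\<Sum>i\<in>B \<times> {..p}. c i * a (v i) (fst j) (snd j)) *
      (x ^ snd j * fst j))"
    unfolding sum_distrib_left sum_distrib_right
    by (subst sum.swap) (simp add: case_prod_unfold mult.assoc)
  also have "\<dots> = 0"
    using c(3) by (intro sum.neutral) simp
  finally have "(\<Sum>i\<le>p. e i ^ p * y i) = 0" .
  \<comment> \<open>Independence of \<open>B\<close> over \<open>k(x)\<close> turns
    \<open>e i = 0\<close> into \<open>r (b, i) = 0\<close> for all \<open>b\<close>, so some
    \<open>e i\<close> survives.\<close>
  moreover have "\<exists>i\<le>p. e i \<noteq> 0"
  proof (rule ccontr)
    assume *: "\<not> (\<exists>i\<le>p. e i \<noteq> 0)"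
    have "c (b, i) = 0" if "b \<in> B" "i \<le> p" for b i
      using indep [THEN spec, of "\<lambda>b. r (b, i)"] * r that p_pos by (auto simp: e_def)
    with c(2) show False
      by auto
  qed
  ultimately show ?thesis
    by blast
qed

end

section \<open>Kaehler differentials\<close>

context finite_curve_function_field
begin

interpretation kaehler: module "\<lambda>a :: 'a. Poly_Mapping.map ((*) a) :: ('a \<Rightarrow>\<^sub>0 'a) \<Rightarrow> _"
  by (rule module_poly_mapping)

section \<open>Relations among Kaehler differentials\<close>

lemma kaehler_relations_diff:
  "v \<in> kaehler_relations emb \<Longrightarrow> w \<in> kaehler_relations emb \<Longrightarrow> v - w \<in> kaehler_relations emb"
  unfolding kaehler_relations_def by (rule kaehler.span_diff)

lemma kaehler_relations_add:
  "v \<in> kaehler_relations emb \<Longrightarrow> w \<in> kaehler_relations emb \<Longrightarrow> v + w \<in> kaehler_relations emb"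
  unfolding kaehler_relations_def by (rule kaehler.span_add)

lemma kaehler_relations_scale:
  "w \<in> kaehler_relations emb \<Longrightarrow> Poly_Mapping.map ((*) a) w \<in> kaehler_relations emb"
  unfolding kaehler_relations_def by (rule kaehler.span_scale)

lemma kaehler_relation_add:
  "Poly_Mapping.single (x + y) 1 - Poly_Mapping.single x 1 - Poly_Mapping.single y 1
     \<in> kaehler_relations emb"
  unfolding kaehler_relations_def by (rule kaehler.span_base) blast

lemma kaehler_relation_mult:
  "Poly_Mapping.single (x * y) 1 - Poly_Mapping.single y x - Poly_Mapping.single x y
     \<in> kaehler_relations emb"
  unfolding kaehler_relations_def by (rule kaehler.span_base) blast

lemma kaehler_relation_emb: "Poly_Mapping.single (emb c) 1 \<in> kaehler_relations emb"
  unfolding kaehler_relations_def by (rule kaehler.span_base) blast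

lemma kaehler_class_eq_iff:
  "kaehler_class emb v = kaehler_class emb w \<longleftrightarrow> v - w \<in> kaehler_relations emb"
proof
  have "v \<in> kaehler_class emb v"
    using kaehler.span_zero by (simp add: kaehler_class_def kaehler_relations_def)
  moreover assume "kaehler_class emb v = kaehler_class emb w"
  ultimately have "v \<in> kaehler_class emb w"
    by simp
  then show "v - w \<in> kaehler_relations emb"
    by (simp add: kaehler_class_def)
next
  assume "v - w \<in> kaehler_relations emb"
  then have "u - v \<in> kaehler_relations emb \<longleftrightarrow> u - w \<in> kaehler_relations emb" for u
    using kaehler_relations_add [of "u - v" "v - w"] kaehler_relations_diff [of "u - w" "v - w"]
    by auto
  then show "kaehler_class emb v = kaehler_class emb w"
    by (auto simp: kaehler_class_def)
qed

lemma kaehler_relation_power: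
  "Poly_Mapping.single (b ^ n) 1 - Poly_Mapping.single b (of_nat n * b ^ (n - 1))
     \<in> kaehler_relations emb"
proof (induction n)
  case 0
  then show ?case
    using kaehler_relation_emb [of 1] by (simp add: emb_one)
next
  case (Suc n)
  have 1: "b * (of_nat n * b ^ (n - Suc 0)) = of_nat n * b ^ n"
    by (cases n) (simp_all add: algebra_simps)
  have "Poly_Mapping.single (b ^ n) b - Poly_Mapping.single b (of_nat n * b ^ n)
      \<in> kaehler_relations emb"
    using kaehler_relations_scale [OF Suc, of b]
    by (simp add: kaehler.scale_right_diff_distrib 1)
  from kaehler_relations_add [OF kaehler_relation_mult [of b "b ^ n"] this] show ?case
    by (simp add: single_add algebra_simps)
qed

text \<open>The power rule gives \<open>d(b ^ p) = p b ^ (p - 1) db = 0\<close>: elements of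
  \<open>F ^ p\<close> behave like constants.\<close>

lemma kaehler_relation_frobenius: "Poly_Mapping.single (b ^ p) 1 \<in> kaehler_relations emb"
  using kaehler_relation_power [of b p] by (simp add: of_nat_p)

section \<open>Polynomials with coefficients in \<open>F ^ p\<close>\<close>

abbreviation frobenius_field :: "'a set" where
  "frobenius_field \<equiv> range (\<lambda>z. z ^ p)"

lemma is_subfield_frobenius_field: "is_subfield frobenius_field"
  by (rule is_subfield_frobenius_image) (simp add: is_subfield_def)

definition frobenius_poly :: "'a poly \<Rightarrow> bool" where
  "frobenius_poly f \<longleftrightarrow> (\<forall>n. coeff f n \<in> frobenius_field)"

lemma frobenius_poly_add: "frobenius_poly f \<Longrightarrow> frobenius_poly g \<Longrightarrow> frobenius_poly (f + g)"
  unfolding frobenius_poly_def coeff_add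
  by (blast intro: subfield_add [OF is_subfield_frobenius_field])

lemma frobenius_poly_diff: "frobenius_poly f \<Longrightarrow> frobenius_poly g \<Longrightarrow> frobenius_poly (f - g)"
  unfolding frobenius_poly_def coeff_diff
  by (blast intro: subfield_diff [OF is_subfield_frobenius_field])

lemma frobenius_poly_mult: "frobenius_poly f \<Longrightarrow> frobenius_poly g \<Longrightarrow> frobenius_poly (f * g)"
  unfolding frobenius_poly_def coeff_mult
  by (intro allI subfield_sum [OF is_subfield_frobenius_field]
      subfield_mult [OF is_subfield_frobenius_field]) blast+

lemma frobenius_poly_const: "frobenius_poly [:a ^ p:]"
  using subfield_0 [OF is_subfield_frobenius_field]
  by (auto simp: frobenius_poly_def coeff_pCons split: nat.split)

lemma frobenius_poly_X: "frobenius_poly [:0, 1:]"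
  using subfield_0 [OF is_subfield_frobenius_field] subfield_1 [OF is_subfield_frobenius_field]
  by (auto simp: frobenius_poly_def coeff_pCons split: nat.split)

text \<open>Coefficients in \<open>F ^ p\<close> have zero differential, so the chain rule leaves
  only \<open>f'(t) dt\<close>. This is why \<open>dt\<close> generates once every element is such
  an \<open>f(t)\<close>.\<close>

lemma kaehler_relation_poly:
  assumes "frobenius_poly f"
  shows "Poly_Mapping.single (poly f t) 1 - Poly_Mapping.single t (poly (pderiv f) t)
    \<in> kaehler_relations emb"
  using assms
proof (induction f)
  case 0
  then show ?case
    using kaehler_relation_emb [of 0] by simp
next
  case (pCons a f)
  let ?g = "poly f t" and ?g' = "poly (pderiv f) t"
  have "coeff f n \<in> frobenius_field" for n
    using pCons.prems [unfolded frobenius_poly_def, THEN spec, of "Suc n"] by simp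
  then have "frobenius_poly f"
    by (simp add: frobenius_poly_def)
  from kaehler_relations_scale [OF pCons.IH [OF this], of t]
  have 1: "Poly_Mapping.single ?g t - Poly_Mapping.single t (t * ?g') \<in> kaehler_relations emb"
    by (simp add: kaehler.scale_right_diff_distrib)
  have "a \<in> frobenius_field"
    using pCons.prems [unfolded frobenius_poly_def, THEN spec, of 0] by simp
  then have 2: "Poly_Mapping.single a 1 \<in> kaehler_relations emb"
    using kaehler_relation_frobenius by auto
  \<comment> \<open>The summands are, in turn, additivity of \<open>d\<close>, the Leibniz rule for
    \<open>t * ?g\<close>, the induction hypothesis times \<open>t\<close>, and
    \<open>da = 0\<close>.\<close>
  have "Poly_Mapping.single (poly (pCons a f) t) 1 -
      Poly_Mapping.single t (poly (pderiv (pCons a f)) t) =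
    (Poly_Mapping.single (a + t * ?g) 1 - Poly_Mapping.single a 1 - Poly_Mapping.single (t * ?g) 1) +
    (Poly_Mapping.single (t * ?g) 1 - Poly_Mapping.single ?g t - Poly_Mapping.single t ?g) +
    (Poly_Mapping.single ?g t - Poly_Mapping.single t (t * ?g')) + Poly_Mapping.single a 1"
    by (simp add: pderiv_pCons single_add)
  also have "\<dots> \<in> kaehler_relations emb"
    by (intro kaehler_relations_add kaehler_relation_add kaehler_relation_mult 1 2)
  finally show ?case .
qed

context
  fixes P t
  assumes P: "P \<in> points emb" and t: "t \<noteq> 0" "P t = 1"
begin

text \<open>The nonzero summands have orders that are pairwise incongruent modulo \<open>p\<close>.\<close>

lemma uniformizer_powers_independent:
  assumes sum: "(\<Sum>i<p. c i ^ p * t ^ i) = 0" and "i < p"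
  shows "c i = 0"
proof (rule ccontr)
  assume "c i \<noteq> 0"
  define S where "S = {i. i < p \<and> c i \<noteq> 0}"
  define ord where "ord i = int p * P (c i) + int i" for i
  have S: "finite S" "S \<noteq> {}"
    using \<open>c i \<noteq> 0\<close> \<open>i < p\<close> by (auto simp: S_def)
  have ord: "c i ^ p * t ^ i \<noteq> 0 \<and> P (c i ^ p * t ^ i) = ord i" if "i \<in> S" for i
    using that t by (simp add: S_def ord_def point_mult [OF P] point_power [OF P])
  have inj: "i = j" if "i \<in> S" "j \<in> S" "ord i = ord j" for i j
  proof -
    have "int i = ord i mod int p" "int j = ord j mod int p"
      using that(1,2) by (simp_all add: ord_def S_def)
    with that(3) show ?thesis
      by (metis of_nat_eq_iff)
  qed
  \<comment> \<open>The term of least order cannot be cancelled, as all others have strictly larger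
    order.\<close>
  obtain j where j: "j \<in> S" "\<And>i. i \<in> S \<Longrightarrow> ord j \<le> ord i"
    using S arg_min_if_finite [OF S, of ord] by (metis linorder_not_less)
  have "order_ge P (ord j + 1) (\<Sum>i\<in>S - {j}. c i ^ p * t ^ i)"
  proof (rule order_ge_sum [OF P])
    fix i assume "i \<in> S - {j}"
    then have "ord j < ord i"
      using j inj by (metis DiffE insertI1 order_le_less)
    with \<open>i \<in> S - {j}\<close> show "order_ge P (ord j + 1) (c i ^ p * t ^ i)"
      using ord [of i] by (simp add: order_ge_def)
  qed
  moreover have "(\<Sum>i\<in>S. c i ^ p * t ^ i) = 0"
  proof -
    have "(\<Sum>i<p. c i ^ p * t ^ i) = (\<Sum>i\<in>S. c i ^ p * t ^ i)"
      using p_pos by (intro sum.mono_neutral_right) (auto simp: S_def)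
    with sum show ?thesis
      by simp
  qed
  then have "(\<Sum>i\<in>S - {j}. c i ^ p * t ^ i) = - (c j ^ p * t ^ j)"
    using j S by (simp add: sum.remove eq_neg_iff_add_eq_0 add.commute)
  ultimately have "order_ge P (ord j + 1) (c j ^ p * t ^ j)"
    by (simp add: order_ge_minus [OF P])
  then show False
    using ord [OF j(1)] by (simp add: order_ge_def)
qed

text \<open>The \<open>p + 1\<close> elements \<open>1, t, ..., t ^ (p - 1), z\<close> are dependent
  over \<open>F ^ p\<close>. Independence of the powers of \<open>t\<close> keeps the coefficient of
  \<open>z\<close> from vanishing, so the relation can be solved for \<open>z\<close>.\<close>

lemma ex_frobenius_poly: "\<exists>f. frobenius_poly f \<and> poly f t = z"
proof -
  obtain c where c: "\<exists>i\<le>p. c i \<noteq> 0" "(\<Sum>i\<le>p. c i ^ p * (if i < p then t ^ i else z)) = 0"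
    using frobenius_dependent [of "\<lambda>i. if i < p then t ^ i else z"] by blast
  then have sum: "(\<Sum>i<p. c i ^ p * t ^ i) + c p ^ p * z = 0"
    by (simp flip: lessThan_Suc_atMost)
  have "c p \<noteq> 0"
  proof
    assume "c p = 0"
    then have "c i = 0" if "i < p" for i
      using sum that p_pos uniformizer_powers_independent [of c i] by (simp add: zero_power)
    with c(1) \<open>c p = 0\<close> show False
      by (metis order_le_less)
  qed
  define f where "f = (\<Sum>i<p. monom ((- c i / c p) ^ p) i)"
  have "frobenius_poly f"
    unfolding frobenius_poly_def f_def coeff_sum
    using subfield_0 [OF is_subfield_frobenius_field]
    by (intro allI subfield_sum [OF is_subfield_frobenius_field]) simp
  moreover have "poly f t = z"
  proof -
    have "(- x :: 'a) ^ p = - (x ^ p)" for x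
      using frobenius_diff [of 0 x] p_pos by simp
    then have "poly f t = - (\<Sum>i<p. c i ^ p * t ^ i) / c p ^ p"
      by (simp add: f_def poly_sum poly_monom power_divide sum_divide_distrib sum_negf)
    also have "(\<Sum>i<p. c i ^ p * t ^ i) = - (c p ^ p * z)"
      using sum by (simp add: eq_neg_iff_add_eq_0)
    also have "- (- (c p ^ p * z)) / c p ^ p = z"
      using \<open>c p \<noteq> 0\<close> by simp
    finally show ?thesis .
  qed
  ultimately show ?thesis
    by blast
qed

text \<open>Makes differentiation of \<open>f(t)\<close> by \<open>t\<close> independent of the
  choice of \<open>f\<close>. Reduction modulo \<open>X ^ p - t ^ p\<close> keeps both
  \<open>f(t)\<close> and \<open>f'(t)\<close>, and a polynomial over \<open>F ^ p\<close> of degree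
  below \<open>p\<close> with root \<open>t\<close> is zero.\<close>

lemma pderiv_eq_0_if_root:
  assumes "frobenius_poly f" "poly f t = 0"
  shows "poly (pderiv f) t = 0"
proof -
  obtain s where s: "\<forall>l<p. s l \<in> frobenius_field" "poly f t = (\<Sum>l<p. s l * t ^ l)"
    "poly (pderiv f) t = (\<Sum>l<p. of_nat l * s l * t ^ (l - 1))"
    using poly_power_reduction [OF is_subfield_frobenius_field p_pos of_nat_p, of t f] assms(1)
    unfolding frobenius_poly_def by blast
  from s(1) have "\<forall>l. \<exists>c. l < p \<longrightarrow> s l = c ^ p"
    by blast
  then obtain c where c: "\<And>l. l < p \<Longrightarrow> s l = c l ^ p"
    by metis
  with s(2) assms(2) have "(\<Sum>l<p. c l ^ p * t ^ l) = 0"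
    by simp
  then have "c l = 0" if "l < p" for l
    using that uniformizer_powers_independent [of c l] by blast
  then show ?thesis
    using s(3) c p_pos by (simp add: zero_power)
qed

end

text \<open>The derivation \<open>d/dt\<close>. For a uniformizer \<open>t\<close> a suitable
  \<open>f\<close> exists by \<open>ex_frobenius_poly\<close>, and its choice is immaterial by
  \<open>derivation_eqI\<close>.\<close>

definition derivation :: "'a \<Rightarrow> 'a \<Rightarrow> 'a" where
  "derivation t z = poly (pderiv (SOME f. frobenius_poly f \<and> poly f t = z)) t"

text \<open>The linear functional \<open>dz \<mapsto> dz/dt\<close> on the free module that presents the Kaehler differentials.\<close>

definition coefficient_wrt :: "'a \<Rightarrow> ('a \<Rightarrow>\<^sub>0 'a) \<Rightarrow> 'a" where
  "coefficient_wrt t w = (\<Sum>z\<in>Poly_Mapping.keys w. Poly_Mapping.lookup w z * derivation t z)"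

lemma coefficient_wrt_superset:
  assumes "finite S" "Poly_Mapping.keys w \<subseteq> S"
  shows "coefficient_wrt t w = (\<Sum>z\<in>S. Poly_Mapping.lookup w z * derivation t z)"
  unfolding coefficient_wrt_def using assms
  by (intro sum.mono_neutral_left) (auto simp: in_keys_iff)

lemma coefficient_wrt_add: "coefficient_wrt t (v + w) = coefficient_wrt t v + coefficient_wrt t w"
proof -
  let ?S = "Poly_Mapping.keys v \<union> Poly_Mapping.keys w"
  have "Poly_Mapping.keys (v + w) \<subseteq> ?S"
    by (rule Poly_Mapping.keys_add)
  then show ?thesis
    by (simp add: coefficient_wrt_superset [of ?S] lookup_add distrib_right sum.distrib)
qed

lemma coefficient_wrt_scale: "coefficient_wrt t (Poly_Mapping.map ((*) a) w) = a * coefficient_wrt t w"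
proof -
  have lookup: "Poly_Mapping.lookup (Poly_Mapping.map ((*) a) w) z = a * Poly_Mapping.lookup w z" for z
    by (simp add: map.rep_eq when_def)
  then have "Poly_Mapping.keys (Poly_Mapping.map ((*) a) w) \<subseteq> Poly_Mapping.keys w"
    by (auto simp: in_keys_iff)
  then show ?thesis
    by (simp add: coefficient_wrt_superset [of "Poly_Mapping.keys w"] lookup sum_distrib_left mult.assoc)
qed

lemma coefficient_wrt_0: "coefficient_wrt t 0 = 0"
  by (simp add: coefficient_wrt_def)

lemma coefficient_wrt_diff: "coefficient_wrt t (v - w) = coefficient_wrt t v - coefficient_wrt t w"
  using coefficient_wrt_add [of t "v - w" w] by simp

lemma coefficient_wrt_single: "coefficient_wrt t (Poly_Mapping.single z u) = u * derivation t z"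
  by (simp add: coefficient_wrt_def)

context
  fixes P t
  assumes P: "P \<in> points emb" and t: "t \<noteq> 0" "P t = 1"
begin

lemma derivation_eqI:
  assumes "frobenius_poly f" "poly f t = z"
  shows "derivation t z = poly (pderiv f) t"
proof -
  define g where "g = (SOME f. frobenius_poly f \<and> poly f t = z)"
  have g: "frobenius_poly g" "poly g t = z"
    using someI_ex [OF ex_frobenius_poly [OF P t, of z]] by (simp_all add: g_def)
  have "poly (pderiv (g - f)) t = 0"
    using assms g by (intro pderiv_eq_0_if_root [OF P t] frobenius_poly_diff) simp_all
  then show ?thesis
    by (simp add: derivation_def g_def [symmetric] pderiv_diff)
qed

lemma derivation_add: "derivation t (x + y) = derivation t x + derivation t y"
proof -
  obtain f g where f: "frobenius_poly f" "poly f t = x" and g: "frobenius_poly g" "poly g t = y"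
    using ex_frobenius_poly [OF P t] by metis
  show ?thesis
    using derivation_eqI [OF f] derivation_eqI [OF g]
      derivation_eqI [OF frobenius_poly_add [OF f(1) g(1)], of "x + y"] f g
    by (simp add: pderiv_add)
qed

lemma derivation_mult: "derivation t (x * y) = x * derivation t y + y * derivation t x"
proof -
  obtain f g where f: "frobenius_poly f" "poly f t = x" and g: "frobenius_poly g" "poly g t = y"
    using ex_frobenius_poly [OF P t] by metis
  show ?thesis
    using derivation_eqI [OF f] derivation_eqI [OF g]
      derivation_eqI [OF frobenius_poly_mult [OF f(1) g(1)], of "x * y"] f g
    by (simp add: pderiv_mult)
qed

lemma derivation_emb: "derivation t (emb c) = 0"
  using emb_eq_frobenius [of c] derivation_eqI [OF frobenius_poly_const]
  by (auto simp: pderiv_pCons)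

lemma derivation_uniformizer: "derivation t t = 1"
  using derivation_eqI [OF frobenius_poly_X, of t] by (simp add: pderiv_pCons)

text \<open>The generators of the relations express laws that \<open>derivation t\<close> satisfies.
  Together with \<open>derivation_uniformizer\<close> this shows
  \<open>dt \<noteq> 0\<close>.\<close>

lemma coefficient_wrt_relations:
  assumes "w \<in> kaehler_relations emb"
  shows "coefficient_wrt t w = 0"
proof -
  have "kaehler.subspace {w. coefficient_wrt t w = 0}"
    by (rule kaehler.subspaceI)
      (simp_all add: coefficient_wrt_0 coefficient_wrt_add coefficient_wrt_scale)
  then have "kaehler_relations emb \<subseteq> {w. coefficient_wrt t w = 0}"
    unfolding kaehler_relations_def
    by (intro kaehler.span_minimal)
      (auto simp: coefficient_wrt_diff coefficient_wrt_single derivation_add derivation_mult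
        derivation_emb)
  with assms show ?thesis
    by blast
qed

lemma kaehler_relation_single:
  "Poly_Mapping.single z u - Poly_Mapping.single t (u * derivation t z) \<in> kaehler_relations emb"
proof -
  obtain f where f: "frobenius_poly f" "poly f t = z"
    using ex_frobenius_poly [OF P t] by metis
  have "Poly_Mapping.single z 1 - Poly_Mapping.single t (derivation t z) \<in> kaehler_relations emb"
    using kaehler_relation_poly [OF f(1), of t] f(2) derivation_eqI [OF f] by simp
  from kaehler_relations_scale [OF this, of u] show ?thesis
    by (simp add: kaehler.scale_right_diff_distrib)
qed

text \<open>The half that says \<open>dt\<close> generates; the induction adds one symbol
  \<open>dz\<close> at a time.\<close>

lemma kaehler_relation_coefficient:
  "w - Poly_Mapping.single t (coefficient_wrt t w) \<in> kaehler_relations emb"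
proof (induction w rule: update_induct)
  case const
  then show ?case
    using kaehler.span_zero by (simp add: coefficient_wrt_0 kaehler_relations_def)
next
  case (update w z u)
  have "Poly_Mapping.update z u w = w + Poly_Mapping.single z u"
    using update by (intro poly_mapping_eqI)
      (auto simp: lookup_update lookup_add lookup_single when_def in_keys_iff)
  then show ?case
    using kaehler_relations_add [OF update.IH kaehler_relation_single [of z u]]
    by (simp add: coefficient_wrt_add coefficient_wrt_single single_add algebra_simps)
qed

lemma kaehler_relations_iff: "w \<in> kaehler_relations emb \<longleftrightarrow> coefficient_wrt t w = 0"
  using coefficient_wrt_relations [of w] kaehler_relation_coefficient [of w] by auto

end

text \<open>Since \<open>dt\<close> is a basis, the coefficient described by \<open>THE\<close>
  exists uniquely and is given by the functional.\<close>

lemma local_coefficient_kaehler_class: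
  assumes P: "P \<in> points emb"
  shows "local_coefficient emb P (kaehler_class emb w) = coefficient_wrt (uniformizer P) w"
  unfolding local_coefficient_def kaehler_class_eq_iff kaehler_relations_iff [OF P uniformizer [OF P]]
  by (simp add: coefficient_wrt_diff coefficient_wrt_single
      derivation_uniformizer [OF P uniformizer [OF P]])

end

section \<open>The two codes\<close>

context finite_curve_function_field
begin

lemma kaehler_relations_iff_coefficient_eq_0:
  "P \<in> points emb \<Longrightarrow> w \<in> kaehler_relations emb \<longleftrightarrow> coefficient_wrt (uniformizer P) w = 0"
  by (rule kaehler_relations_iff [OF _ uniformizer])

lemma kaehler_class_eq_zero_iff:
  assumes "P \<in> points emb"
  shows "kaehler_class emb w = zero_differential emb \<longleftrightarrow> coefficient_wrt (uniformizer P) w = 0"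
  using kaehler_relations_iff_coefficient_eq_0 [OF assms, of w]
  by (simp add: zero_differential_def kaehler_class_eq_iff)

text \<open>One point \<open>P\<close> suffices to see that the differentials form a line over
  \<open>F\<close>: each is \<open>f\<close> times the class of \<open>w\<close>, with
  \<open>f\<close> the quotient of the two coefficients at \<open>P\<close>. Orders add, which turns
  the bound \<open>E\<close> into \<open>K - E\<close>.\<close>

lemma differential_space_eq:
  assumes "points emb \<noteq> {}"
    and w: "kaehler_class emb w \<noteq> zero_differential emb"
    and K: "\<And>P. P \<in> points emb \<Longrightarrow>
      Poly_Mapping.lookup K P = differential_order emb P (kaehler_class emb w)"
  shows "differential_space emb E =
    (\<lambda>f. kaehler_class emb (Poly_Mapping.map ((*) f) w)) ` riemann_roch_space emb (K - E)"
proof -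
  let ?fw = "\<lambda>f. kaehler_class emb (Poly_Mapping.map ((*) f) w)"
  obtain P where P: "P \<in> points emb"
    using assms(1) by blast
  have nz: "coefficient_wrt (uniformizer Q) w \<noteq> 0" if "Q \<in> points emb" for Q
    using w kaehler_class_eq_zero_iff [OF that] by blast
  have zero_iff: "?fw f = zero_differential emb \<longleftrightarrow> f = 0" for f
    using nz [OF P] by (simp add: kaehler_class_eq_zero_iff [OF P] coefficient_wrt_scale)
  have order: "differential_order emb Q (?fw f) = Q f + Poly_Mapping.lookup K Q"
    if "Q \<in> points emb" "f \<noteq> 0" for Q f
    using that nz by (simp add: K differential_order_def local_coefficient_kaehler_class
        coefficient_wrt_scale point_mult)
  have mem_iff: "?fw f \<in> differential_space emb E \<longleftrightarrow> f \<in> riemann_roch_space emb (K - E)" for f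
  proof -
    have "?fw f \<in> differential_space emb E \<longleftrightarrow>
        (f \<noteq> 0 \<longrightarrow> (\<forall>Q\<in>points emb. Poly_Mapping.lookup E Q \<le> Q f + Poly_Mapping.lookup K Q))"
      by (simp add: differential_space_def differentials_def zero_iff order)
    also have "\<dots> \<longleftrightarrow> f \<in> riemann_roch_space emb (K - E)"
      unfolding riemann_roch_space_def lookup_minus mem_Collect_eq
      by (intro imp_cong ball_cong refl) linarith
    finally show ?thesis .
  qed
  have "\<exists>f. \<omega> = ?fw f" if \<omega>: "\<omega> \<in> differentials emb" for \<omega>
  proof -
    obtain v where v: "\<omega> = kaehler_class emb v"
      using \<omega> by (auto simp: differentials_def)
    define f where "f = coefficient_wrt (uniformizer P) v / coefficient_wrt (uniformizer P) w"
    have "coefficient_wrt (uniformizer P) (v - Poly_Mapping.map ((*) f) w) = 0"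
      using nz [OF P] by (simp add: coefficient_wrt_diff coefficient_wrt_scale f_def)
    then have "\<omega> = ?fw f"
      using kaehler_relations_iff_coefficient_eq_0 [OF P] by (simp add: v kaehler_class_eq_iff)
    then show ?thesis ..
  qed
  moreover have "differential_space emb E \<subseteq> differentials emb"
    by (auto simp: differential_space_def)
  ultimately show ?thesis
    using mem_iff by blast
qed

lemma residue_at_scaled:
  assumes rational: "P \<in> rational_points emb"
    and f: "order_ge P (- 1) (f * coefficient_wrt (uniformizer P) w)"
  shows "residue_at emb P (kaehler_class emb (Poly_Mapping.map ((*) f) w)) =
    value_at emb P (f * (coefficient_wrt (uniformizer P) w * uniformizer P))"
proof -
  have "P \<in> points emb"
    using rational rational_points_subset by blast
  then show ?thesis
    using f residue_at_simple_pole [OF rational, of "kaehler_class emb (Poly_Mapping.map ((*) f) w)"]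
    by (simp add: local_coefficient_kaehler_class coefficient_wrt_scale mult.assoc)
qed

lemma minimum_distance_code_Omega:
  assumes canonical: "canonical_divisor emb K"
    and dist: "distinct Ps" and rational: "set Ps \<subseteq> rational_points emb"
    and disjoint: "\<And>P. P \<in> set Ps \<Longrightarrow> Poly_Mapping.lookup G P = 0"
  shows "minimum_distance (code_Omega emb Ps G) =
    Inf {enat (nat (divisor_degree emb A)) | A.
       is_divisor emb A \<and> divisor_le 0 A \<and> divisor_le A (points_divisor Ps) \<and>
       riemann_roch_space emb (A - (G - K)) \<noteq> riemann_roch_space emb (- (G - K))}"
proof -
  obtain w where w: "kaehler_class emb w \<noteq> zero_differential emb"
    and K: "\<And>P. P \<in> points emb \<Longrightarrow>
      Poly_Mapping.lookup K P = differential_order emb P (kaehler_class emb w)"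
    using canonical unfolding canonical_divisor_def differentials_def by blast
  \<comment> \<open>The order of \<open>h P\<close> is that of \<open>K\<close> at \<open>P\<close>
    plus one, as required for \<open>C = G - K\<close> because \<open>G\<close> vanishes at
    \<open>P\<close>.\<close>
  define h where "h P = coefficient_wrt (uniformizer P) w * uniformizer P" for P
  have pts: "P \<in> points emb" if "P \<in> set Ps" for P
    using that rational rational_points_subset by blast
  have u: "coefficient_wrt (uniformizer P) w \<noteq> 0 \<and>
      P (coefficient_wrt (uniformizer P) w) = Poly_Mapping.lookup K P" if "P \<in> set Ps" for P
    using w kaehler_class_eq_zero_iff [OF pts [OF that]]
    by (simp add: K pts that differential_order_def local_coefficient_kaehler_class)
  have h: "h P \<noteq> 0 \<and> P (h P) = 1 - Poly_Mapping.lookup (G - K) P" if "P \<in> set Ps" for P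
    using u [OF that] uniformizer [OF pts [OF that]]
    by (simp add: h_def point_mult [OF pts [OF that]] lookup_minus disjoint that)
  have "code_Omega emb Ps G = (\<lambda>f. map (\<lambda>P. value_at emb P (f * h P)) Ps) `
      riemann_roch_space emb (points_divisor Ps - (G - K))"
  \<comment> \<open>If \<open>D = 0\<close>, both codes consist of the empty word. Otherwise a point
    of \<open>D\<close> serves to compare differentials.\<close>
  proof (cases "Ps = []")
    case True
    have "kaehler_class emb 0 \<in> differential_space emb (G - points_divisor Ps)"
      by (simp add: differential_space_def differentials_def zero_differential_def)
    with True show ?thesis
      using zero_in_riemann_roch_space by (auto simp: code_Omega_def)
  next
    case False
    then have ne: "points emb \<noteq> {}"
      using pts by (cases Ps) auto
    have residue: "residue_at emb P (kaehler_class emb (Poly_Mapping.map ((*) f) w)) =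
        value_at emb P (f * h P)"
      if "P \<in> set Ps" "f \<in> riemann_roch_space emb (points_divisor Ps - (G - K))" for P f
    proof -
      \<comment> \<open>The product of \<open>f\<close> with the differential of divisor
        \<open>K\<close> thus has at most a simple pole at \<open>P\<close>.\<close>
      have "order_ge P (- 1 - Poly_Mapping.lookup K P) f"
        using that(2) [unfolded riemann_roch_space_iff, THEN bspec, OF pts [OF that(1)]] that(1)
        by (simp add: lookup_minus lookup_points_divisor dist disjoint)
      then show ?thesis
        unfolding h_def using that(1) rational u [OF that(1)]
        by (intro residue_at_scaled) (auto simp: order_ge_mult_iff [OF pts])
    qed
    have "differential_space emb (G - points_divisor Ps) =
        (\<lambda>f. kaehler_class emb (Poly_Mapping.map ((*) f) w)) `
          riemann_roch_space emb (points_divisor Ps - (G - K))"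
      using differential_space_eq [OF ne w, of K "G - points_divisor Ps"] K
      by (simp add: algebra_simps)
    then show ?thesis
      unfolding code_Omega_def by (simp only: image_image) (intro image_cong refl, simp add: residue)
  qed
  then show ?thesis
    using minimum_distance_evaluation_code [OF finite dist rational h] by simp
qed

end

text \<open>Plain evaluation is the case \<open>h = 1\<close>: at the points of \<open>D\<close> the
  divisor \<open>C = D - G\<close> has coefficient one, matching the order \<open>0\<close> of the
  constant function.\<close>

lemma (in curve_function_field) minimum_distance_code_L:
  assumes "finite (UNIV :: 'k set)"
    and dist: "distinct Ps" and rational: "set Ps \<subseteq> rational_points emb"
    and disjoint: "\<And>P. P \<in> set Ps \<Longrightarrow> Poly_Mapping.lookup G P = 0"
  shows "minimum_distance (code_L emb Ps G) =
    Inf {enat (nat (divisor_degree emb A)) | A.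
       is_divisor emb A \<and> divisor_le 0 A \<and> divisor_le A (points_divisor Ps) \<and>
       riemann_roch_space emb (A - (points_divisor Ps - G)) \<noteq>
         riemann_roch_space emb (- (points_divisor Ps - G))}"
proof -
  have "P 1 = 0" if "P \<in> set Ps" for P
    using that rational rational_points_subset point_1 by blast
  then show ?thesis
    using minimum_distance_evaluation_code [OF assms(1) dist rational,
        of "\<lambda>_. 1" "points_divisor Ps - G"]
    by (simp add: code_L_def lookup_minus lookup_points_divisor dist disjoint)
qed

theorem proposition2p1:
  fixes emb :: "'k::{field,finite} \<Rightarrow> 'a::field"
    and Ps :: "'a point list"
    and D G K :: "'a divisor"
  assumes "curve_function_field emb"
    and "canonical_divisor emb K"
    and "distinct Ps"
    and "set Ps \<subseteq> rational_points emb"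
    and "D = points_divisor Ps"
    and "is_divisor emb G"
    and "Poly_Mapping.keys G \<inter> Poly_Mapping.keys D = {}"
  shows
    "(let C = D - G in
        minimum_distance (code_L emb Ps G) =
          Inf {enat (nat (divisor_degree emb A)) | A.
             is_divisor emb A \<and> divisor_le 0 A \<and> divisor_le A D \<and>
             riemann_roch_space emb (A - C) \<noteq> riemann_roch_space emb (- C)})
     \<and>
     (let C = G - K in
        minimum_distance (code_Omega emb Ps G) =
          Inf {enat (nat (divisor_degree emb A)) | A.
             is_divisor emb A \<and> divisor_le 0 A \<and> divisor_le A D \<and>
             riemann_roch_space emb (A - C) \<noteq> riemann_roch_space emb (- C)})"
proof -
  interpret finite_curve_function_field emb "CHAR('a)"
    using assms(1) by (simp add: finite_curve_function_field_def finite_curve_function_field_axioms_def)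
  have "Poly_Mapping.lookup G P = 0" if "P \<in> set Ps" for P
    using assms(3,5,7) that by (auto simp: keys_points_divisor in_keys_iff)
  then show ?thesis
    unfolding Let_def assms(5)
    using minimum_distance_code_L [OF finite assms(3,4)]
      minimum_distance_code_Omega [OF assms(2-4)] by blast
qed

end
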